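(* For any suitable elementary submodel $M$ the following holds. Let $X$ be a complete metric space, $\mathbf{P}$ be a porosity-like relation on $X$, and $\mathbf{P}'$ be a porosity-like relation on $X_M$. Suppose that $N_{\mathbf{P}}(S)$ is a Suslin set whenever $S\subset X$ is Suslin. Assume $M$ contains $X$, $\mathbf{P}$, and a Suslin set $A\subset X$. Then whenever $M$ is a pointwise $(\mathbf{P}\leftrightarrow\mathbf{P}')$-model, the following hold: (1) $A$ is $\mathbf{P}$-porous in the space $X$ $\iff$ $A\cap X_M$ is $\mathbf{P}'$-porous in the space $X_M$; (2) $A$ is $\sigma$-$\mathbf{P}$-porous in the space $X$ $\iff$ $A\cap X_M$ is $\sigma$-$\mathbf{P}'$-porous in the space $X_M$.
   Context: Elementary submodels. For a set $N$ and a formula $\phi$ of the language of ZFC, $\phi^N$ (the relativization) is obtained by replacing each quantifier "$\forall x$" by "$\forall x\in N$" and each "$\exists x$" by "$\exists x\in N$". A formula $\phi(x_1,\dots,x_n)$ (all free variables shown) is absolute for $N$ if for all $a_1,\dots,a_n\in N$: $\phi^N(a_1,\dots,a_n)\leftrightarrow\phi(a_1,\dots,a_n)$. For formulas $\phi_1,\dots,\phi_n$ and a countable set $Y$, write $M\prec(\phi_1,\dots,\phi_n;Y)$ if $M\supset Y$ is a countable set such that $\phi_1,\dots,\phi_n$ are absolute for $M$. The phrase "for any suitable elementary submodel $M$ the following holds: ..." means: there exist a list of formulas $\phi_1,\dots,\phi_n$ and a countable set $Y$ such that for every $M\prec(\phi_1,\dots,\phi_n;Y)$ the following holds: ... (so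 the list and $Y$ are chosen before $X$, $\mathbf{P}$, $\mathbf{P}'$, $A$). "$M$ contains an object" means the object is an element of $M$; for a metric space $X$ this means $(X,\rho)\in M$. $X_M:=\overline{X\cap M}$ (closure in $X$), with the inherited metric. Porosity-like relations. A porosity-like relation on a metric space $X$ is a relation $\mathbf{P}\subset X\times\mathcal{P}(X)$ between points and subsets of $X$ such that (i) if $A\subset B$ and $\mathbf{P}(x,B)$ then $\mathbf{P}(x,A)$; (ii) $\mathbf{P}(x,A)$ iff there is $r>0$ with $\mathbf{P}(x,A\cap U(x,r))$, where $U(x,r)$ is the open ball; (iii) $\mathbf{P}(x,A)$ iff $\mathbf{P}(x,\overline{A})$. A set $A$ is $\mathbf{P}$-porous if $\mathbf{P}(x,A)$ for every $x\in A$, and $\sigma$-$\mathbf{P}$-porous if it is a countable union of $\mathbf{P}$-porous sets. $N_{\mathbf{P}}(A)=\{x\in A: \neg\mathbf{P}(x,A)\}$. $M$ is a pointwise $(\mathbf{P}\leftrightarrow\mathbf{P}')$-model if for all $A\in\mathcal{P}(X)\cap M$ and all $x\in X_M$: $\mathbf{P}(x,A)\leftrightarrow\mathbf{P}'(x,A\cap X_M)$. A subset of a topological space is Suslin if it has the form $\bigcup_{\nu\in\omega^\omega}\bigcap_{n\in\omega}F(\nu|n)$, where $F(s)$, $s\in\omega^{<\omega}$, are closed sets and $\nu|n=(\nu_0,\dots,\nu_{n-1})$. *)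

theory Defs
  imports "HOL-Analysis.Analysis"
begin

section \<open>The set-theoretic universe\<close>

text \<open>
  A type of class \<open>zfc\<close> plays the role of the universe of all sets; \<open>x\<close> is a member of \<open>a\<close> when
  \<open>x \<in> elts a\<close>. Separation and replacement range over all HOL predicates and functions. Consequently
  the axiom of choice is not assumed: it follows from Hilbert choice (lemma \<open>zfc_choice\<close>).
\<close>

class zfc =
  fixes elts :: "'a \<Rightarrow> 'a set"
  assumes extensionality: "elts a = elts b \<Longrightarrow> a = b"
    and foundation: "elts a \<noteq> {} \<Longrightarrow> \<exists>b \<in> elts a. elts b \<inter> elts a = {}"
    and pairing: "\<exists>c. elts c = {a, b}"
    and union: "\<exists>b. elts b = (\<Union>x \<in> elts a. elts x)"
    and powerset: "\<exists>b. elts b = {x. elts x \<subseteq> elts a}"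
    and separation: "\<exists>b. elts b = {x \<in> elts a. Q x}"
    and replacement: "\<exists>b. elts b = F ` elts a"
    and infinity: "\<exists>a. (\<exists>z \<in> elts a. elts z = {}) \<and>
                       (\<forall>x \<in> elts a. \<exists>y \<in> elts a. elts y = insert x (elts x))"

lemma zfc_choice:
  fixes a :: "'v::zfc"
  assumes "\<And>x. x \<in> elts a \<Longrightarrow> elts x \<noteq> {}"
    and "\<And>x y. x \<in> elts a \<Longrightarrow> y \<in> elts a \<Longrightarrow> x \<noteq> y \<Longrightarrow> elts x \<inter> elts y = {}"
  shows "\<exists>c. \<forall>x \<in> elts a. \<exists>!z. z \<in> elts x \<inter> elts c"
proof -
  obtain c where c: "elts c = (\<lambda>x. SOME z. z \<in> elts x) ` elts a"
    using replacement[of "\<lambda>x. SOME z. z \<in> elts x" a] by (elim exE)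
  have ch: "(SOME z. z \<in> elts x) \<in> elts x" if "x \<in> elts a" for x
    using assms(1)[OF that] by (simp add: some_in_eq)
  have "\<exists>!z. z \<in> elts x \<inter> elts c" if x: "x \<in> elts a" for x
  proof (rule ex1I)
    show "(SOME z. z \<in> elts x) \<in> elts x \<inter> elts c"
      using ch[OF x] x c by blast
    fix z assume z: "z \<in> elts x \<inter> elts c"
    then obtain y where y: "y \<in> elts a" "z = (SOME z. z \<in> elts y)"
      using c by auto
    then have "z \<in> elts y" using ch by blast
    then have "x = y" using assms(2)[OF x y(1)] z by blast
    then show "z = (SOME z. z \<in> elts x)" using y by simp
  qed
  then show ?thesis by blast
qed

text \<open>A HOL set of objects of the universe is small if it is itself (the extension of) a set of the
  universe, which is then \<open>vset A\<close>; otherwise it is a proper class and \<open>vset A\<close> is meaningless.\<close>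

definition small :: "'v::zfc set \<Rightarrow> bool" where
  "small A \<longleftrightarrow> (\<exists>a. elts a = A)"

definition vset :: "'v::zfc set \<Rightarrow> 'v" where
  "vset A = (THE a. elts a = A)"

definition vpair :: "'v::zfc \<Rightarrow> 'v \<Rightarrow> 'v" where
  "vpair a b = vset {vset {a}, vset {a, b}}"

lemma small_elts [simp]: "small (elts a)"
  unfolding small_def by blast

lemma elts_vset: "small A \<Longrightarrow> elts (vset A) = A"
  unfolding small_def vset_def by (rule theI') (blast intro: extensionality)

lemma small_subset:
  assumes "small B" "A \<subseteq> B" shows "small A"
proof -
  obtain b where b: "elts b = B" using assms(1) unfolding small_def by blast
  obtain c where "elts c = {x \<in> elts b. x \<in> A}" using separation[of b "\<lambda>x. x \<in> A"] by (elim exE)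
  moreover have "{x \<in> elts b. x \<in> A} = A" using b assms(2) by auto
  ultimately show ?thesis unfolding small_def by auto
qed

lemma small_image:
  fixes f :: "'v::zfc \<Rightarrow> 'v"
  shows "small A \<Longrightarrow> small (f ` A)"
  unfolding small_def using replacement[of f] by auto

lemma small_Union:
  fixes f :: "'v::zfc \<Rightarrow> 'v set"
  assumes "small A" "\<And>x. x \<in> A \<Longrightarrow> small (f x)"
  shows "small (\<Union>x\<in>A. f x)"
proof -
  obtain b where b: "elts b = (\<lambda>x. vset (f x)) ` A"
    using small_image[OF assms(1), of "\<lambda>x. vset (f x)"] unfolding small_def by (elim exE)
  obtain c where "elts c = (\<Union>x \<in> elts b. elts x)" using union[of b] by (elim exE)
  then have "elts c = (\<Union>x\<in>A. f x)" using b assms(2) by (simp add: elts_vset)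
  then show ?thesis unfolding small_def by blast
qed

lemma small_vset_Pow:
  assumes "small A" shows "small (vset ` Pow A)"
proof -
  obtain a where a: "elts a = A" using assms unfolding small_def by blast
  obtain b where b: "elts b = {x. elts x \<subseteq> elts a}" using powerset[of a] by (elim exE)
  have "vset B \<in> elts b" if "B \<subseteq> A" for B
    using that a b elts_vset[OF small_subset[OF assms that]] by simp
  then have "vset ` Pow A \<subseteq> elts b" by auto
  then show ?thesis using small_subset small_elts by blast
qed

lemma small_doubleton [simp]: "small {a, b}"
  unfolding small_def using pairing by blast

lemma small_singleton [simp]: "small {a}"
  using small_doubleton[of a a] by simp

lemma not_self_member: "x \<notin> elts x"
proof
  assume x: "x \<in> elts x"
  obtain c where "elts c = {x}" using pairing[of x x] by auto
  then show False using foundation[of c] x by auto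
qed

lemma small_countable:
  fixes A :: "'v::zfc set"
  assumes "countable A" shows "small A"
proof (cases "A = {}")
  case True
  obtain b :: 'v where "elts b = {x \<in> elts undefined. False}" using separation[of undefined "\<lambda>_. False"] by (elim exE)
  then show ?thesis using True unfolding small_def by auto
next
  case False
  obtain a z :: 'v where z: "z \<in> elts a"
    and suc: "\<forall>x \<in> elts a. \<exists>y \<in> elts a. elts y = insert x (elts x)"
    using infinity by blast
  obtain g where g: "\<And>x. x \<in> elts a \<Longrightarrow> g x \<in> elts a \<and> elts (g x) = insert x (elts x)"
    using bchoice[OF suc[unfolded Bex_def]] by blast
  define s where "s n = (g ^^ n) z" for n
  have s_in: "s n \<in> elts a" for n
    by (induction n) (auto simp: s_def z g)
  have s_Suc: "elts (s (Suc n)) = insert (s n) (elts (s n))" for n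
    using g[OF s_in[of n]] by (simp add: s_def)
  have less: "m < n \<Longrightarrow> s m \<in> elts (s n)" for m n
    by (induction n) (auto simp: s_Suc less_Suc_eq)
  have inj: "inj s"
    by (rule linorder_injI) (metis less not_self_member)
  define F where "F x = from_nat_into A (inv s x)" for x
  have "A = F ` range s"
    using assms False inj
    by (simp add: F_def image_image range_from_nat_into)
  moreover have "small (range s)"
    using small_subset[OF small_elts, of "range s" a] s_in by blast
  ultimately show ?thesis using small_image by metis
qed

lemma vset_eq_iff: "small A \<Longrightarrow> small B \<Longrightarrow> vset A = vset B \<longleftrightarrow> A = B"
  by (metis elts_vset)

lemma vpair_eq_iff: "vpair a b = vpair c d \<longleftrightarrow> a = c \<and> b = d"
proof
  assume "vpair a b = vpair c d"
  then have "{vset {a}, vset {a, b}} = {vset {c}, vset {c, d}}"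
    by (simp only: vpair_def vset_eq_iff small_doubleton)
  then have "vset {a} = vset {c} \<and> vset {a, b} = vset {c, d} \<or>
             vset {a} = vset {c, d} \<and> vset {a, b} = vset {c}"
    by (simp only: doubleton_eq_iff)
  then have "{a} = {c} \<and> {a, b} = {c, d} \<or> {a} = {c, d} \<and> {a, b} = {c}"
    by (simp only: vset_eq_iff small_doubleton small_singleton)
  then show "a = c \<and> b = d"
    by (metis doubleton_eq_iff insert_absorb2)
qed simp


section \<open>Formulas of the language of set theory\<close>

text \<open>Variables are named by natural numbers.\<close>

datatype fm =
    Mem nat nat
  | Eql nat nat
  | Neg fm
  | Conj fm fm
  | Disj fm fm
  | Impl fm fm
  | Forall nat fm
  | Exists nat fm

primrec fv :: "fm \<Rightarrow> nat set" where
  "fv (Mem i j) = {i, j}"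
| "fv (Eql i j) = {i, j}"
| "fv (Neg \<phi>) = fv \<phi>"
| "fv (Conj \<phi> \<psi>) = fv \<phi> \<union> fv \<psi>"
| "fv (Disj \<phi> \<psi>) = fv \<phi> \<union> fv \<psi>"
| "fv (Impl \<phi> \<psi>) = fv \<phi> \<union> fv \<psi>"
| "fv (Forall i \<phi>) = fv \<phi> - {i}"
| "fv (Exists i \<phi>) = fv \<phi> - {i}"

text \<open>\<open>holds N e \<phi>\<close> is the truth of the relativization of \<open>\<phi>\<close> to \<open>N\<close> under the assignment \<open>e\<close>;
  \<open>holds UNIV e \<phi>\<close> is the truth of \<open>\<phi>\<close> itself.\<close>

primrec holds :: "'v::zfc set \<Rightarrow> (nat \<Rightarrow> 'v) \<Rightarrow> fm \<Rightarrow> bool" where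
  "holds N e (Mem i j) \<longleftrightarrow> e i \<in> elts (e j)"
| "holds N e (Eql i j) \<longleftrightarrow> e i = e j"
| "holds N e (Neg \<phi>) \<longleftrightarrow> \<not> holds N e \<phi>"
| "holds N e (Conj \<phi> \<psi>) \<longleftrightarrow> holds N e \<phi> \<and> holds N e \<psi>"
| "holds N e (Disj \<phi> \<psi>) \<longleftrightarrow> holds N e \<phi> \<or> holds N e \<psi>"
| "holds N e (Impl \<phi> \<psi>) \<longleftrightarrow> (holds N e \<phi> \<longrightarrow> holds N e \<psi>)"
| "holds N e (Forall i \<phi>) \<longleftrightarrow> (\<forall>x\<in>N. holds N (e(i := x)) \<phi>)"
| "holds N e (Exists i \<phi>) \<longleftrightarrow> (\<exists>x\<in>N. holds N (e(i := x)) \<phi>)"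

definition absolute_for :: "'v::zfc set \<Rightarrow> fm \<Rightarrow> bool" where
  "absolute_for N \<phi> \<longleftrightarrow>
     (\<forall>e. (\<forall>i\<in>fv \<phi>. e i \<in> N) \<longrightarrow> (holds N e \<phi> \<longleftrightarrow> holds UNIV e \<phi>))"

text \<open>Countable HOL sets of objects are small (lemma \<open>small_countable\<close>), so it makes no difference that \<open>M\<close> and \<open>Y\<close> are HOL
  sets and not objects of the universe.\<close>

definition elem_submodel :: "'v::zfc set \<Rightarrow> fm list \<Rightarrow> 'v set \<Rightarrow> bool" where
  "elem_submodel M \<phi>s Y \<longleftrightarrow> Y \<subseteq> M \<and> countable M \<and> (\<forall>\<phi>\<in>set \<phi>s. absolute_for M \<phi>)"


section \<open>Metric spaces and relations as objects of the universe\<close>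

text \<open>The universe contains an implementation of the real numbers, given here by an injection \<open>rc\<close>
  that names the object representing each real. The metric space with carrier \<open>X\<close> and metric \<open>d\<close> is
  the pair of \<open>X\<close> and the graph of \<open>d\<close> on \<open>X\<close>.\<close>

definition vmetric_space :: "(real \<Rightarrow> 'v::zfc) \<Rightarrow> 'v set \<Rightarrow> ('v \<Rightarrow> 'v \<Rightarrow> real) \<Rightarrow> 'v" where
  "vmetric_space rc X d =
     vpair (vset X) (vset ((\<lambda>(x, y). vpair (vpair x y) (rc (d x y))) ` (X \<times> X)))"

definition vrelation :: "('v::zfc \<times> 'v set) set \<Rightarrow> 'v" where
  "vrelation P = vset ((\<lambda>(x, A). vpair x (vset A)) ` P)"

text \<open>The sets to which \<open>vset\<close> is applied above are indeed small.\<close>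

lemma small_metric_graph:
  assumes "small X"
  shows "small ((\<lambda>(x, y). vpair (vpair x y) (rc (d x y))) ` (X \<times> X))"
proof -
  have "(\<lambda>(x, y). vpair (vpair x y) (rc (d x y))) ` (X \<times> X)
      = (\<Union>x\<in>X. (\<lambda>y. vpair (vpair x y) (rc (d x y))) ` X)" by auto
  then show ?thesis by (simp only: small_Union[OF assms small_image[OF assms]])
qed

lemma small_relation:
  assumes "small X" "P \<subseteq> X \<times> Pow X"
  shows "small ((\<lambda>(x, A). vpair x (vset A)) ` P)"
proof -
  have "(\<lambda>(x, A). vpair x (vset A)) ` P \<subseteq> (\<Union>x\<in>X. vpair x ` (vset ` Pow X))"
  proof (rule image_subsetI)
    fix p assume "p \<in> P"
    then obtain x A where "p = (x, A)" "x \<in> X" "A \<in> Pow X" using assms(2) by auto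
    then show "(case p of (x, A) \<Rightarrow> vpair x (vset A)) \<in> (\<Union>x\<in>X. vpair x ` (vset ` Pow X))"
      by (intro UN_I[of x]) simp_all
  qed
  moreover have "small (\<Union>x\<in>X. vpair x ` (vset ` Pow X))"
    by (rule small_Union[OF assms(1) small_image[OF small_vset_Pow[OF assms(1)]]])
  ultimately show ?thesis by (rule small_subset[rotated])
qed


section \<open>Porosity-like relations and Suslin sets\<close>

definition porosity_like :: "'a set \<Rightarrow> ('a \<Rightarrow> 'a \<Rightarrow> real) \<Rightarrow> ('a \<times> 'a set) set \<Rightarrow> bool" where
  "porosity_like X d P \<longleftrightarrow>
     P \<subseteq> X \<times> Pow X \<and>
     (\<forall>x\<in>X. \<forall>A B. A \<subseteq> B \<and> B \<subseteq> X \<and> (x, B) \<in> P \<longrightarrow> (x, A) \<in> P) \<and>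
     (\<forall>x\<in>X. \<forall>A. A \<subseteq> X \<longrightarrow>
        ((x, A) \<in> P \<longleftrightarrow> (\<exists>r>0. (x, A \<inter> Metric_space.mball X d x r) \<in> P))) \<and>
     (\<forall>x\<in>X. \<forall>A. A \<subseteq> X \<longrightarrow>
        ((x, A) \<in> P \<longleftrightarrow> (x, Metric_space.mtopology X d closure_of A) \<in> P))"

definition porous :: "('a \<times> 'a set) set \<Rightarrow> 'a set \<Rightarrow> bool" where
  "porous P A \<longleftrightarrow> (\<forall>x\<in>A. (x, A) \<in> P)"

definition sigma_porous :: "('a \<times> 'a set) set \<Rightarrow> 'a set \<Rightarrow> bool" where
  "sigma_porous P A \<longleftrightarrow> (\<exists>\<C>. countable \<C> \<and> (\<forall>B\<in>\<C>. porous P B) \<and> A = \<Union>\<C>)"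

definition nonporous_points :: "('a \<times> 'a set) set \<Rightarrow> 'a set \<Rightarrow> 'a set" where
  "nonporous_points P A = {x \<in> A. (x, A) \<notin> P}"

definition suslin_in :: "'a topology \<Rightarrow> 'a set \<Rightarrow> bool" where
  "suslin_in T A \<longleftrightarrow>
     (\<exists>F :: nat list \<Rightarrow> 'a set.
        (\<forall>s. closedin T (F s)) \<and>
        A = (\<Union>\<nu> :: nat \<Rightarrow> nat. \<Inter>n. F (map \<nu> [0..<n])))"

definition submodel_space ::
    "'v set \<Rightarrow> ('v \<Rightarrow> 'v \<Rightarrow> real) \<Rightarrow> 'v set \<Rightarrow> 'v set" where
  "submodel_space X d M = Metric_space.mtopology X d closure_of (X \<inter> M)"

definition pointwise_model ::
    "'v::zfc set \<Rightarrow> ('v \<Rightarrow> 'v \<Rightarrow> real) \<Rightarrow> 'v set \<Rightarrow>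
     ('v \<times> 'v set) set \<Rightarrow> ('v \<times> 'v set) set \<Rightarrow> bool" where
  "pointwise_model X d M P P' \<longleftrightarrow>
     (\<forall>A. A \<subseteq> X \<and> vset A \<in> M \<longrightarrow>
        (\<forall>x\<in>submodel_space X d M. (x, A) \<in> P \<longleftrightarrow> (x, A \<inter> submodel_space X d M) \<in> P'))"

end

theory Submission
  imports Defs
begin

text \<open>
  The countable set of parameters consists of names of the natural numbers, the set of these
  names, and the relation \<open>r < 1 / (n + 1)\<close> between reals and natural numbers. Beyond these,
  the only fact about elementary submodels that the proof uses is closure under witnesses: if
  a formula \<open>\<phi>\<close> and \<open>\<exists>x. \<phi>\<close> are both absolute for \<open>M\<close>, then whenever \<open>\<exists>x. \<phi>\<close> is true with
  parameters in \<open>M\<close>, a true witness lies in \<open>M\<close> (lemma \<open>absolute_imp_skolem_closed\<close>). A fixed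
  finite list of predicates, \<open>witness_predicates\<close>, is shown to be definable, and the formulas
  of the theorem are those that define them, together with their existential closures.

  Write \<open>Y\<close> for the closure of \<open>X \<inter> M\<close>. For porosity, if \<open>A\<close> is not porous at some point of
  \<open>A\<close>, then such a point exists in \<open>M\<close>, hence in \<open>Y\<close>, and the pointwise model moves the
  porosity relation between \<open>A\<close> and \<open>A \<inter> Y\<close>. For a \<open>\<sigma>\<close>-porous \<open>A\<close>, a sequence of porous sets
  covering \<open>A\<close> can be chosen in \<open>M\<close>; its terms then lie in \<open>M\<close>, and their traces on \<open>Y\<close> are
  porous.

  The remaining direction is a Baire category argument in the manner of Foran. Suppose that
  \<open>A\<close> is not \<open>\<sigma>\<close>-porous and that \<open>C k\<close> are porous subsets of \<open>Y\<close>. Let the nodes be the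
  non-\<open>\<sigma>\<close>-porous subsets of \<open>A\<close>. Three facts about them are needed.

  \<^item> A set that is \<open>\<sigma>\<close>-porous near each of its points is \<open>\<sigma>\<close>-porous, even in a nonseparable
    space (lemma \<open>sigma_porous_Union_open\<close>). Hence every node \<open>E\<close> contains a kernel: a node
    \<open>T\<close> such that \<open>T \<inter> U\<close> is a node for every open ball \<open>U\<close> centred in \<open>T\<close>.

  \<^item> The points of a kernel \<open>T\<close> at which \<open>T\<close> is not porous again form a node, and this node
    lies in the set of points of \<open>cl T\<close> at which \<open>cl T\<close> is not porous. The latter set is
    Suslin, although \<open>T\<close> need not be.

  \<^item> A Suslin set \<open>s\<close> attaches to each of its points a branch of natural numbers in such a way
    that a limit of points of \<open>s\<close> whose branches converge lies in \<open>s\<close> (lemma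
    \<open>suslin_in_branches\<close>). Since \<open>\<sigma>\<close>-porous sets form a \<open>\<sigma>\<close>-ideal, every node inside \<open>s\<close>
    contains a node on which the \<open>n\<close>-th coordinate of the branch is constant.

  These facts are packed into one object, a Foran system, that can be chosen in \<open>M\<close>. A
  decreasing sequence of nodes in \<open>M\<close> with diameters tending to 0 is then built. To avoid
  \<open>C k\<close>, take a kernel \<open>T\<close> of the current node. Either some ball around a point of \<open>T \<inter> M\<close> is
  disjoint from \<open>C k\<close>, and a node inside a smaller concentric ball is next; or \<open>T \<inter> Y\<close> lies in
  the closure of \<open>C k\<close>, so that \<open>T\<close> is porous at every point of \<open>C k\<close>, and the Suslin set of
  the second fact is disjoint from \<open>C k\<close>. Dovetailing, every coordinate of the branches of \<open>A\<close>
  and of all the Suslin sets met in this way is made constant at some step. By completeness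
  the nodes shrink to a point of \<open>Y\<close>, which lies in \<open>A\<close> and in all these Suslin sets, hence in
  no \<open>C k\<close> (lemma \<open>ex_point_outside\<close>).
\<close>

section \<open>Definable predicates and witnesses in submodels\<close>

text \<open>
  All properties handed to a submodel are HOL predicates on assignments. Working with the mere
  existence of a defining formula makes it possible to prove definability by introduction
  rules that follow the syntax of the predicate.
\<close>

definition definable :: "((nat \<Rightarrow> 'v::zfc) \<Rightarrow> bool) \<Rightarrow> bool" where
  "definable Q \<longleftrightarrow> (\<exists>\<phi>. \<forall>e. holds UNIV e \<phi> \<longleftrightarrow> Q e)"

lemma finite_fv: "finite (fv \<phi>)"
  by (induction \<phi>) auto

lemma holds_cong:
  "(\<And>i. i \<in> fv \<phi> \<Longrightarrow> e i = e' i) \<Longrightarrow> holds N e \<phi> \<longleftrightarrow> holds N e' \<phi>"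
proof (induction \<phi> arbitrary: e e')
  case (Forall i \<phi>)
  have "holds N (e(i := x)) \<phi> \<longleftrightarrow> holds N (e'(i := x)) \<phi>" for x
    by (rule Forall.IH) (use Forall.prems in auto)
  then show ?case by simp
next
  case (Exists i \<phi>)
  have "holds N (e(i := x)) \<phi> \<longleftrightarrow> holds N (e'(i := x)) \<phi>" for x
    by (rule Exists.IH) (use Exists.prems in auto)
  then show ?case by simp
next
  case (Conj \<phi> \<psi>)
  have "holds N e \<phi> \<longleftrightarrow> holds N e' \<phi>" "holds N e \<psi> \<longleftrightarrow> holds N e' \<psi>"
    by (rule Conj.IH; simp add: Conj.prems)+
  then show ?case by simp
next
  case (Disj \<phi> \<psi>)
  have "holds N e \<phi> \<longleftrightarrow> holds N e' \<phi>" "holds N e \<psi> \<longleftrightarrow> holds N e' \<psi>"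
    by (rule Disj.IH; simp add: Disj.prems)+
  then show ?case by simp
next
  case (Impl \<phi> \<psi>)
  have "holds N e \<phi> \<longleftrightarrow> holds N e' \<phi>" "holds N e \<psi> \<longleftrightarrow> holds N e' \<psi>"
    by (rule Impl.IH; simp add: Impl.prems)+
  then show ?case by simp
next
  case (Neg \<phi>)
  have "holds N e \<phi> \<longleftrightarrow> holds N e' \<phi>"
    by (rule Neg.IH) (simp add: Neg.prems)
  then show ?case by simp
qed simp_all

text \<open>
  Bound variables are replaced by fresh ones to avoid capture. The lemma serves the quantifier
  rule \<open>definable_Ex\<close>, which shifts all variables in de Bruijn style and therefore has no
  freshness condition.
\<close>

lemma rename_variables:
  "\<exists>\<psi>. \<forall>e::nat \<Rightarrow> 'v::zfc. holds N e \<psi> \<longleftrightarrow> holds N (\<lambda>i. e (f i)) \<phi>"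
proof (induction \<phi> arbitrary: f)
  case (Mem i j)
  show ?case by (rule exI[of _ "Mem (f i) (f j)"]) simp
next
  case (Eql i j)
  show ?case by (rule exI[of _ "Eql (f i) (f j)"]) simp
next
  case (Neg \<phi>)
  from Neg.IH[of f] obtain \<phi>'
    where \<phi>': "\<forall>e::nat \<Rightarrow> 'v. holds N e \<phi>' \<longleftrightarrow> holds N (\<lambda>i. e (f i)) \<phi>" ..
  show ?case by (rule exI[of _ "Neg \<phi>'"]) (simp add: \<phi>')
next
  case (Conj \<phi> \<psi>)
  from Conj.IH(1)[of f] obtain \<phi>'
    where \<phi>': "\<forall>e::nat \<Rightarrow> 'v. holds N e \<phi>' \<longleftrightarrow> holds N (\<lambda>i. e (f i)) \<phi>" ..
  from Conj.IH(2)[of f] obtain \<psi>'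
    where \<psi>': "\<forall>e::nat \<Rightarrow> 'v. holds N e \<psi>' \<longleftrightarrow> holds N (\<lambda>i. e (f i)) \<psi>" ..
  show ?case by (rule exI[of _ "Conj \<phi>' \<psi>'"]) (simp add: \<phi>' \<psi>')
next
  case (Disj \<phi> \<psi>)
  from Disj.IH(1)[of f] obtain \<phi>'
    where \<phi>': "\<forall>e::nat \<Rightarrow> 'v. holds N e \<phi>' \<longleftrightarrow> holds N (\<lambda>i. e (f i)) \<phi>" ..
  from Disj.IH(2)[of f] obtain \<psi>'
    where \<psi>': "\<forall>e::nat \<Rightarrow> 'v. holds N e \<psi>' \<longleftrightarrow> holds N (\<lambda>i. e (f i)) \<psi>" ..
  show ?case by (rule exI[of _ "Disj \<phi>' \<psi>'"]) (simp add: \<phi>' \<psi>')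
next
  case (Impl \<phi> \<psi>)
  from Impl.IH(1)[of f] obtain \<phi>'
    where \<phi>': "\<forall>e::nat \<Rightarrow> 'v. holds N e \<phi>' \<longleftrightarrow> holds N (\<lambda>i. e (f i)) \<phi>" ..
  from Impl.IH(2)[of f] obtain \<psi>'
    where \<psi>': "\<forall>e::nat \<Rightarrow> 'v. holds N e \<psi>' \<longleftrightarrow> holds N (\<lambda>i. e (f i)) \<psi>" ..
  show ?case by (rule exI[of _ "Impl \<phi>' \<psi>'"]) (simp add: \<phi>' \<psi>')
next
  case (Forall i \<phi>)
  obtain k where k: "k \<notin> f ` fv \<phi>"
    using ex_new_if_finite[OF infinite_UNIV_nat] finite_fv by blast
  from Forall.IH[of "f(i := k)"] obtain \<psi>
    where \<psi>: "\<forall>e::nat \<Rightarrow> 'v. holds N e \<psi> \<longleftrightarrow> holds N (\<lambda>j. e ((f(i := k)) j)) \<phi>" ..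
  have "holds N (e(k := x)) \<psi> \<longleftrightarrow> holds N ((\<lambda>j. e (f j))(i := x)) \<phi>" for e :: "nat \<Rightarrow> 'v" and x
    unfolding \<psi>[rule_format] by (rule holds_cong) (use k in auto)
  then have "holds N e (Forall k \<psi>) \<longleftrightarrow> holds N (\<lambda>j. e (f j)) (Forall i \<phi>)" for e :: "nat \<Rightarrow> 'v"
    by simp
  then show ?case by (intro exI allI)
next
  case (Exists i \<phi>)
  obtain k where k: "k \<notin> f ` fv \<phi>"
    using ex_new_if_finite[OF infinite_UNIV_nat] finite_fv by blast
  from Exists.IH[of "f(i := k)"] obtain \<psi>
    where \<psi>: "\<forall>e::nat \<Rightarrow> 'v. holds N e \<psi> \<longleftrightarrow> holds N (\<lambda>j. e ((f(i := k)) j)) \<phi>" ..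
  have "holds N (e(k := x)) \<psi> \<longleftrightarrow> holds N ((\<lambda>j. e (f j))(i := x)) \<phi>" for e :: "nat \<Rightarrow> 'v" and x
    unfolding \<psi>[rule_format] by (rule holds_cong) (use k in auto)
  then have "holds N e (Exists k \<psi>) \<longleftrightarrow> holds N (\<lambda>j. e (f j)) (Exists i \<phi>)" for e :: "nat \<Rightarrow> 'v"
    by simp
  then show ?case by (intro exI allI)
qed

lemma definable_Mem: "definable (\<lambda>e. e i \<in> elts (e j))"
  unfolding definable_def by (rule exI[of _ "Mem i j"]) simp

lemma definable_Eql: "definable (\<lambda>e. e i = e j)"
  unfolding definable_def by (rule exI[of _ "Eql i j"]) simp

lemma definableI: "(\<And>e. holds UNIV e \<phi> \<longleftrightarrow> Q e) \<Longrightarrow> definable Q"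
  unfolding definable_def by blast

lemma definableE:
  assumes "definable Q"
  obtains \<phi> where "\<And>e. holds UNIV e \<phi> \<longleftrightarrow> Q e"
  using assms unfolding definable_def by blast

lemma definable_Neg:
  assumes "definable Q" shows "definable (\<lambda>e. \<not> Q e)"
proof -
  obtain \<phi> where "\<And>e. holds UNIV e \<phi> \<longleftrightarrow> Q e" using assms by (rule definableE) blast
  then show ?thesis by (intro definableI[of "Neg \<phi>"]) simp
qed

lemma definable_Conj:
  assumes "definable Q" "definable R" shows "definable (\<lambda>e. Q e \<and> R e)"
proof -
  obtain \<phi> where "\<And>e. holds UNIV e \<phi> \<longleftrightarrow> Q e" using assms(1) by (rule definableE) blast
  moreover obtain \<psi> where "\<And>e. holds UNIV e \<psi> \<longleftrightarrow> R e" using assms(2) by (rule definableE) blast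
  ultimately show ?thesis by (intro definableI[of "Conj \<phi> \<psi>"]) simp
qed

lemma definable_Disj:
  assumes "definable Q" "definable R" shows "definable (\<lambda>e. Q e \<or> R e)"
proof -
  obtain \<phi> where "\<And>e. holds UNIV e \<phi> \<longleftrightarrow> Q e" using assms(1) by (rule definableE) blast
  moreover obtain \<psi> where "\<And>e. holds UNIV e \<psi> \<longleftrightarrow> R e" using assms(2) by (rule definableE) blast
  ultimately show ?thesis by (intro definableI[of "Disj \<phi> \<psi>"]) simp
qed

lemma definable_Impl:
  assumes "definable Q" "definable R" shows "definable (\<lambda>e. Q e \<longrightarrow> R e)"
proof -
  obtain \<phi> where "\<And>e. holds UNIV e \<phi> \<longleftrightarrow> Q e" using assms(1) by (rule definableE) blast
  moreover obtain \<psi> where "\<And>e. holds UNIV e \<psi> \<longleftrightarrow> R e" using assms(2) by (rule definableE) blast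
  ultimately show ?thesis by (intro definableI[of "Impl \<phi> \<psi>"]) simp
qed

lemma definable_Iff: "definable Q \<Longrightarrow> definable R \<Longrightarrow> definable (\<lambda>e. Q e \<longleftrightarrow> R e)"
  unfolding iff_conv_conj_imp by (intro definable_Conj definable_Impl)

lemma definable_Ex:
  fixes Q :: "'v::zfc \<Rightarrow> (nat \<Rightarrow> 'v) \<Rightarrow> bool"
  assumes "definable (\<lambda>e. Q (e 0) (\<lambda>i. e (Suc i)))"
  shows "definable (\<lambda>e. \<exists>x. Q x e)"
proof -
  obtain \<phi> where \<phi>: "\<And>e. holds UNIV e \<phi> \<longleftrightarrow> Q (e 0) (\<lambda>i. e (Suc i))"
    using assms by (rule definableE) blast
  obtain n where "\<forall>i\<in>fv \<phi>. i < n"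
    using finite_fv[of \<phi>] unfolding finite_nat_set_iff_bounded by blast
  then have n: "Suc n \<notin> fv \<phi>" by auto
  from rename_variables[of UNIV "case_nat n id" \<phi>] obtain \<psi>
    where \<psi>: "\<forall>e::nat \<Rightarrow> 'v. holds UNIV e \<psi> \<longleftrightarrow> holds UNIV (\<lambda>i. e (case_nat n id i)) \<phi>" ..
  \<comment> \<open>The renaming sends 0 to the fresh variable \<open>n\<close>, which is then quantified, and shifts the
    other variables down.\<close>
  have "holds UNIV (e(n := x)) \<psi> \<longleftrightarrow> holds UNIV (case_nat x e) \<phi>" for e :: "nat \<Rightarrow> 'v" and x
    unfolding \<psi>[rule_format] by (rule holds_cong) (use n in \<open>auto split: nat.splits\<close>)
  then have "holds UNIV e (Exists n \<psi>) \<longleftrightarrow> (\<exists>x. Q x e)" for e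
    by (simp add: \<phi>)
  then show ?thesis by (rule definableI)
qed

lemma definable_All:
  assumes "definable (\<lambda>e. Q (e 0) (\<lambda>i. e (Suc i)))"
  shows "definable (\<lambda>e. \<forall>x. Q x e)"
proof -
  have "definable (\<lambda>e. \<not> (\<exists>x. \<not> Q x e))"
    by (rule definable_Neg, rule definable_Ex, rule definable_Neg, rule assms)
  then show ?thesis by simp
qed

lemma definable_Bex:
  assumes "definable (\<lambda>e. Q (e 0) (\<lambda>i. e (Suc i)))"
  shows "definable (\<lambda>e. \<exists>x\<in>elts (e j). Q x e)"
  unfolding Bex_def by (intro definable_Ex definable_Conj definable_Mem assms)

lemma definable_Ball:
  assumes "definable (\<lambda>e. Q (e 0) (\<lambda>i. e (Suc i)))"
  shows "definable (\<lambda>e. \<forall>x\<in>elts (e j). Q x e)"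
  unfolding Ball_def by (intro definable_All definable_Impl definable_Mem assms)

lemma definable_subset: "definable (\<lambda>e. elts (e i) \<subseteq> elts (e j))"
  unfolding subset_iff by (intro definable_All definable_Impl definable_Mem)

lemma eq_vset_iff: "small A \<Longrightarrow> z = vset A \<longleftrightarrow> elts z = A"
  using elts_vset extensionality by metis

text \<open>
  Spelled out by membership alone: the elements of an ordered pair are exactly the objects
  whose extension is the singleton or the doubleton in Kuratowski's definition.
\<close>

lemma definable_vpair: "definable (\<lambda>e. e i = vpair (e j) (e k))"
proof -
  have "p = vpair a b \<longleftrightarrow>
      (\<forall>z. z \<in> elts p \<longleftrightarrow> (\<forall>u. u \<in> elts z \<longleftrightarrow> u = a) \<or> (\<forall>u. u \<in> elts z \<longleftrightarrow> u = a \<or> u = b))"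
    (is "_ \<longleftrightarrow> ?R p a b") for p a b :: 'a
  proof -
    have "p = vpair a b \<longleftrightarrow> elts p = {vset {a}, vset {a, b}}"
      by (simp add: vpair_def eq_vset_iff)
    also have "\<dots> \<longleftrightarrow> (\<forall>z. z \<in> elts p \<longleftrightarrow> elts z = {a} \<or> elts z = {a, b})"
      by (simp add: set_eq_iff[of "elts p"] eq_vset_iff)
    also have "\<dots> \<longleftrightarrow> ?R p a b" by (simp add: set_eq_iff)
    finally show ?thesis .
  qed
  then show ?thesis
    by (simp only:) (intro definable_All definable_Iff definable_Mem definable_Disj definable_Eql)
qed

lemma definable_vpair_Mem: "definable (\<lambda>e. vpair (e i) (e j) \<in> elts (e k))"
proof -
  have "definable (\<lambda>e. \<exists>p\<in>elts (e k). p = vpair (e i) (e j))"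
    by (intro definable_Bex definable_vpair)
  then show ?thesis by simp
qed

lemma definable_vpair3_Mem: "definable (\<lambda>e. vpair (e i) (vpair (e j) (e l)) \<in> elts (e k))"
proof -
  have "definable (\<lambda>e. \<exists>q. q = vpair (e j) (e l) \<and> vpair (e i) q \<in> elts (e k))"
    by (intro definable_Ex definable_Conj definable_vpair definable_vpair_Mem)
  then show ?thesis by simp
qed

lemma definable_vpair3_Mem': "definable (\<lambda>e. vpair (vpair (e i) (e j)) (e l) \<in> elts (e k))"
proof -
  have "definable (\<lambda>e. \<exists>q. q = vpair (e i) (e j) \<and> vpair q (e l) \<in> elts (e k))"
    by (intro definable_Ex definable_Conj definable_vpair definable_vpair_Mem)
  then show ?thesis by simp
qed

lemmas definable_intros = definable_Mem definable_Eql definable_Neg definable_Conj definable_Disj definable_Impl definable_Iff definable_Bex definable_Ball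
  definable_Ex definable_All definable_subset definable_vpair definable_vpair_Mem definable_vpair3_Mem definable_vpair3_Mem'

text \<open>
  Variable 0 holds the witness, the other variables hold the parameters.
\<close>

definition skolem_closed :: "'v::zfc set \<Rightarrow> ((nat \<Rightarrow> 'v) \<Rightarrow> bool) \<Rightarrow> bool" where
  "skolem_closed M Q \<longleftrightarrow>
     (\<forall>e. range e \<subseteq> M \<longrightarrow> (\<exists>x. Q (e(0 := x))) \<longrightarrow> (\<exists>x\<in>M. Q (e(0 := x))))"

text \<open>
  If \<open>\<exists>x. \<phi>\<close> is true, then by absoluteness it is true in \<open>M\<close>, which yields some \<open>x \<in> M\<close>
  satisfying the relativization of \<open>\<phi>\<close>; by absoluteness of \<open>\<phi>\<close> this \<open>x\<close> satisfies \<open>\<phi>\<close> itself.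
\<close>

lemma absolute_imp_skolem_closed:
  fixes Q :: "(nat \<Rightarrow> 'v::zfc) \<Rightarrow> bool"
  assumes "definable Q"
  shows "\<exists>\<phi>s. \<forall>M. (\<forall>\<phi>\<in>set \<phi>s. absolute_for M \<phi>) \<longrightarrow> skolem_closed M Q"
proof -
  obtain \<phi> where \<phi>: "\<And>e. holds UNIV e \<phi> \<longleftrightarrow> Q e"
    using assms unfolding definable_def by blast
  have "skolem_closed M Q" if "\<forall>\<psi>\<in>set [\<phi>, Exists 0 \<phi>]. absolute_for M \<psi>" for M
    unfolding skolem_closed_def
  proof (intro allI impI)
    fix e assume e: "range e \<subseteq> M" and ex: "\<exists>x. Q (e(0 := x))"
    have "holds UNIV e (Exists 0 \<phi>)" using ex \<phi> by simp
    then have "holds M e (Exists 0 \<phi>)"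
      using that e unfolding absolute_for_def by (simp add: range_subsetD del: holds.simps)
    then obtain x where "x \<in> M" "holds M (e(0 := x)) \<phi>" by auto
    moreover have "\<forall>i\<in>fv \<phi>. (e(0 := x)) i \<in> M"
      using \<open>x \<in> M\<close> e by auto
    ultimately show "\<exists>x\<in>M. Q (e(0 := x))"
      using that \<phi> unfolding absolute_for_def by auto
  qed
  then show ?thesis by blast
qed

lemma absolute_imp_skolem_closed_list:
  fixes Qs :: "((nat \<Rightarrow> 'v::zfc) \<Rightarrow> bool) list"
  assumes "\<forall>Q\<in>set Qs. definable Q"
  shows "\<exists>\<phi>s. \<forall>M. (\<forall>\<phi>\<in>set \<phi>s. absolute_for M \<phi>) \<longrightarrow> (\<forall>Q\<in>set Qs. skolem_closed M Q)"
  using assms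
proof (induction Qs)
  case Nil
  then show ?case by simp
next
  case (Cons Q Qs)
  obtain \<phi>s \<psi>s where
    "\<forall>M. (\<forall>\<phi>\<in>set \<phi>s. absolute_for M \<phi>) \<longrightarrow> (\<forall>Q\<in>set Qs. skolem_closed M Q)"
    "\<forall>M. (\<forall>\<phi>\<in>set \<psi>s. absolute_for M \<phi>) \<longrightarrow> skolem_closed M Q"
    using Cons absolute_imp_skolem_closed[of Q] by auto
  then show ?case by (intro exI[of _ "\<psi>s @ \<phi>s"]) auto
qed

section \<open>The ideal of sigma-porous sets\<close>

lemma porous_empty: "porous P {}"
  by (simp add: porous_def)

lemma sigma_porous_iff_sequence:
  "sigma_porous P B \<longleftrightarrow> (\<exists>c :: nat \<Rightarrow> 'a set. (\<forall>n. porous P (c n)) \<and> B = (\<Union>n. c n))"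
proof
  assume "sigma_porous P B"
  then obtain \<C> where \<C>: "countable \<C>" "\<forall>C\<in>\<C>. porous P C" "B = \<Union>\<C>"
    unfolding sigma_porous_def by blast
  have r: "range (from_nat_into (insert {} \<C>)) = insert {} \<C>"
    using \<C>(1) by (intro range_from_nat_into) auto
  show "\<exists>c :: nat \<Rightarrow> 'a set. (\<forall>n. porous P (c n)) \<and> B = (\<Union>n. c n)"
  proof (intro exI[of _ "from_nat_into (insert {} \<C>)"] conjI allI)
    fix n
    have "from_nat_into (insert {} \<C>) n \<in> insert {} \<C>" using r by blast
    then show "porous P (from_nat_into (insert {} \<C>) n)"
      using \<C>(2) porous_empty by (metis insertE)
  qed (use r \<C>(3) in auto)
next
  assume "\<exists>c :: nat \<Rightarrow> 'a set. (\<forall>n. porous P (c n)) \<and> B = (\<Union>n. c n)"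
  then obtain c :: "nat \<Rightarrow> 'a set" where "\<forall>n. porous P (c n)" "B = (\<Union>n. c n)" by blast
  then show "sigma_porous P B"
    unfolding sigma_porous_def by (intro exI[of _ "range c"]) auto
qed

lemma porous_imp_sigma_porous: "porous P B \<Longrightarrow> sigma_porous P B"
  unfolding sigma_porous_def by (intro exI[of _ "{B}"]) simp

lemma sigma_porous_UN:
  fixes B :: "nat \<Rightarrow> 'a set"
  assumes "\<And>n. sigma_porous P (B n)"
  shows "sigma_porous P (\<Union>n. B n)"
proof -
  obtain \<C> where \<C>: "\<And>n. countable (\<C> n)" "\<And>n. \<forall>C\<in>\<C> n. porous P C" "\<And>n. B n = \<Union>(\<C> n)"
    using assms unfolding sigma_porous_def by metis
  show ?thesis
    unfolding sigma_porous_def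
    by (intro exI[of _ "\<Union>n. \<C> n"]) (use \<C> in auto)
qed

lemma sigma_porous_Un:
  assumes "sigma_porous P B" "sigma_porous P C"
  shows "sigma_porous P (B \<union> C)"
proof -
  have "sigma_porous P (\<Union>n::nat. if n = 0 then B else C)"
    using assms by (intro sigma_porous_UN) auto
  moreover have "(\<Union>n::nat. if n = 0 then B else C) = B \<union> C"
    by (auto split: if_splits)
  ultimately show ?thesis by simp
qed

lemma (in Metric_space) in_closure_of_iff_real:
  assumes "E \<subseteq> M"
  shows "x \<in> mtopology closure_of E \<longleftrightarrow> x \<in> M \<and> (\<forall>r>0. \<exists>y\<in>E. d x y < r)"
  unfolding metric_closure_of mem_Collect_eq in_mball using assms by (meson subsetD)

lemma (in Metric_space) in_closure_of_iff:
  assumes "E \<subseteq> M"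
  shows "x \<in> mtopology closure_of E \<longleftrightarrow> x \<in> M \<and> (\<forall>n. \<exists>y\<in>E. d x y < 1 / Suc n)"
  unfolding in_closure_of_iff_real[OF assms]
proof (intro conj_cong refl iffI allI impI)
  fix n assume "\<forall>r>0. \<exists>y\<in>E. d x y < r"
  then show "\<exists>y\<in>E. d x y < 1 / Suc n" by simp
next
  fix r :: real assume *: "\<forall>n. \<exists>y\<in>E. d x y < 1 / Suc n" and "0 < r"
  obtain n where "1 / real (Suc n) < r"
    using reals_Archimedean[OF \<open>0 < r\<close>] by (auto simp: inverse_eq_divide)
  then show "\<exists>y\<in>E. d x y < r" using * by (meson less_trans)
qed

locale porosity_space = Metric_space X d for X :: "'a set" and d +
  fixes P :: "('a \<times> 'a set) set"
  assumes porosity_like: "porosity_like X d P"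
begin

lemma P_carrier: "(x, B) \<in> P \<Longrightarrow> x \<in> X \<and> B \<subseteq> X"
  using porosity_like[unfolded porosity_like_def, THEN conjunct1] by blast

lemma P_antimono: "(x, B) \<in> P \<Longrightarrow> A \<subseteq> B \<Longrightarrow> (x, A) \<in> P"
  using porosity_like[unfolded porosity_like_def, THEN conjunct2, THEN conjunct1, rule_format]
    P_carrier by meson

lemma P_local: "(x, A \<inter> mball x r) \<in> P \<Longrightarrow> 0 < r \<Longrightarrow> A \<subseteq> X \<Longrightarrow> (x, A) \<in> P"
  using porosity_like[unfolded porosity_like_def, THEN conjunct2, THEN conjunct2, THEN conjunct1,
      rule_format, of x A] P_carrier by meson

lemma P_closure:
  "x \<in> X \<Longrightarrow> A \<subseteq> X \<Longrightarrow> (x, mtopology closure_of A) \<in> P \<longleftrightarrow> (x, A) \<in> P"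
  using porosity_like[unfolded porosity_like_def, THEN conjunct2, THEN conjunct2, THEN conjunct2,
      rule_format, of x A] by simp

lemma porous_carrier: "porous P B \<Longrightarrow> B \<subseteq> X"
  unfolding porous_def using P_carrier by blast

lemma porous_subset: "porous P B \<Longrightarrow> A \<subseteq> B \<Longrightarrow> porous P A"
  unfolding porous_def using P_antimono by blast

lemma sigma_porous_subset:
  assumes "sigma_porous P B" "A \<subseteq> B" shows "sigma_porous P A"
proof -
  obtain \<C> where \<C>: "countable \<C>" "\<forall>C\<in>\<C>. porous P C" "B = \<Union>\<C>"
    using assms(1) unfolding sigma_porous_def by blast
  show ?thesis
    unfolding sigma_porous_def
    by (intro exI[of _ "(\<lambda>C. A \<inter> C) ` \<C>"]) (use \<C> assms(2) porous_subset in auto)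
qed

text \<open>
  A sigma-discrete decomposition as in Stone's theorem. Well-order the open sets and send each
  point \<open>x\<close> to the least one, \<open>f x\<close>, that contains it. Two points \<open>x, y\<close> with \<open>d x y < 1 / n\<close>
  whose balls of radius \<open>1 / n\<close> lie in \<open>f x\<close> and \<open>f y\<close> satisfy \<open>y \<in> f x\<close> and \<open>x \<in> f y\<close>, so
  \<open>f x = f y\<close>. Hence porous pieces taken from different open sets can be united, for fixed
  \<open>n\<close>, without affecting each other locally, and porosity at a point is a local matter.
\<close>

lemma sigma_porous_Union_open:
  assumes "B \<subseteq> X"
    and "\<And>U. U \<in> \<U> \<Longrightarrow> openin mtopology U"
    and "\<And>U. U \<in> \<U> \<Longrightarrow> sigma_porous P (B \<inter> U)"
  shows "sigma_porous P (B \<inter> \<Union>\<U>)"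
proof -
  obtain r :: "'a set rel" where r: "well_order_on UNIV r"
    using well_order_on by blast
  have "\<exists>U\<in>\<U>. x \<in> U \<and> (\<forall>V\<in>\<U>. x \<in> V \<longrightarrow> (U, V) \<in> r)" if x: "x \<in> \<Union>\<U>" for x
  proof -
    have "wf (r - Id)" and tot: "total_on UNIV r" and refl: "refl_on UNIV r"
      using r unfolding well_order_on_def linear_order_on_def partial_order_on_def preorder_on_def
      by auto
    moreover have "{U \<in> \<U>. x \<in> U} \<noteq> {}" using x by blast
    ultimately obtain U where U: "U \<in> {U \<in> \<U>. x \<in> U}"
      "\<And>V. (V, U) \<in> r - Id \<Longrightarrow> V \<notin> {U \<in> \<U>. x \<in> U}"
      by (metis (no_types, lifting) wfE_min ex_in_conv)
    have "(U, V) \<in> r" if "V \<in> \<U>" "x \<in> V" for V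
    proof (cases "U = V")
      case True
      then show ?thesis using refl by (simp add: refl_onD)
    next
      case False
      then have "(V, U) \<notin> r" using U(2)[of V] that by blast
      then show ?thesis using tot False unfolding total_on_def by blast
    qed
    then show ?thesis using U(1) by blast
  qed
  then obtain f where f: "\<And>x. x \<in> \<Union>\<U> \<Longrightarrow> f x \<in> \<U> \<and> x \<in> f x"
    and f_least: "\<And>x V. x \<in> \<Union>\<U> \<Longrightarrow> V \<in> \<U> \<Longrightarrow> x \<in> V \<Longrightarrow> (f x, V) \<in> r"
    by metis
  obtain c :: "'a set \<Rightarrow> nat \<Rightarrow> 'a set" where c: "\<And>U n. U \<in> \<U> \<Longrightarrow> porous P (c U n)"
    "\<And>U. U \<in> \<U> \<Longrightarrow> B \<inter> U = (\<Union>n. c U n)"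
    using assms(3) unfolding sigma_porous_iff_sequence by metis
  define D where
    "D n m = {x \<in> B \<inter> \<Union>\<U>. x \<in> c (f x) m \<and> mball x (1 / Suc n) \<subseteq> f x}" for n m
  have "porous P (D n m)" for n m
    unfolding porous_def
  proof
    fix x assume x: "x \<in> D n m"
    then have xX: "x \<in> X" using assms(1) by (auto simp: D_def)
    have "D n m \<inter> mball x (1 / Suc n) \<subseteq> c (f x) m"
    proof
      fix y assume y: "y \<in> D n m \<inter> mball x (1 / Suc n)"
      then have "x \<in> mball y (1 / Suc n)" by (simp add: commute)
      then have "x \<in> f y" using y by (auto simp: D_def)
      moreover have "y \<in> f x" using x y by (auto simp: D_def)
      ultimately have "(f x, f y) \<in> r" "(f y, f x) \<in> r"
        using f f_least x y unfolding D_def by auto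
      then have "f x = f y"
        using r unfolding well_order_on_def linear_order_on_def partial_order_on_def antisym_def
        by blast
      then show "y \<in> c (f x) m" using y by (auto simp: D_def)
    qed
    moreover have "(x, c (f x) m) \<in> P"
      using x c(1) f unfolding D_def porous_def by auto
    ultimately have "(x, D n m \<inter> mball x (1 / Suc n)) \<in> P"
      using P_antimono by blast
    then show "(x, D n m) \<in> P"
      by (rule P_local) (use assms(1) in \<open>auto simp: D_def\<close>)
  qed
  then have "sigma_porous P (\<Union>n. \<Union>m. D n m)"
    by (intro sigma_porous_UN porous_imp_sigma_porous)
  moreover have "B \<inter> \<Union>\<U> \<subseteq> (\<Union>n. \<Union>m. D n m)"
  proof
    fix x assume x: "x \<in> B \<inter> \<Union>\<U>"
    then obtain m where m: "x \<in> c (f x) m" using c(2) f by blast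
    have "openin mtopology (f x)" using assms(2) f x by blast
    then obtain \<epsilon> where "\<epsilon> > 0" "mball x \<epsilon> \<subseteq> f x"
      using f x unfolding openin_mtopology by blast
    moreover obtain n where "inverse (real (Suc n)) < \<epsilon>" using reals_Archimedean[OF \<open>\<epsilon> > 0\<close>] by blast
    ultimately have "mball x (1 / Suc n) \<subseteq> f x"
      using mball_subset_concentric[of "1 / Suc n" \<epsilon> x] by (simp add: inverse_eq_divide)
    then show "x \<in> (\<Union>n. \<Union>m. D n m)" using x m by (auto simp: D_def)
  qed
  ultimately show ?thesis by (rule sigma_porous_subset)
qed

text \<open>
  The kernel arises by removing every open set in which \<open>E\<close> is sigma-porous.
\<close>

lemma nonporous_kernel:
  assumes E: "E \<subseteq> X" "\<not> sigma_porous P E"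
  obtains T where "T \<subseteq> E" "\<not> sigma_porous P T"
    "\<And>x r. x \<in> T \<Longrightarrow> 0 < r \<Longrightarrow> \<not> sigma_porous P (T \<inter> mball x r)"
proof
  define \<U> where "\<U> = {U. openin mtopology U \<and> sigma_porous P (E \<inter> U)}"
  let ?T = "E - \<Union>\<U>"
  have small: "sigma_porous P (E \<inter> \<Union>\<U>)"
    by (rule sigma_porous_Union_open) (use E in \<open>auto simp: \<U>_def\<close>)
  show "?T \<subseteq> E" by blast
  show "\<not> sigma_porous P ?T"
  proof
    assume "sigma_porous P ?T"
    from sigma_porous_Un[OF this small] have "sigma_porous P E"
      by (rule sigma_porous_subset) blast
    then show False using E by blast
  qed
  fix x r assume x: "x \<in> ?T" and r: "0 < (r::real)"
  show "\<not> sigma_porous P (?T \<inter> mball x r)"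
  proof
    assume "sigma_porous P (?T \<inter> mball x r)"
    from sigma_porous_Un[OF this small] have "sigma_porous P (E \<inter> mball x r)"
      by (rule sigma_porous_subset) blast
    then have "mball x r \<in> \<U>" by (simp add: \<U>_def)
    moreover have "x \<in> mball x r" using x r E by auto
    ultimately show False using x by blast
  qed
qed

lemma not_sigma_porous_nonporous_points:
  assumes "\<not> sigma_porous P T"
  shows "\<not> sigma_porous P (nonporous_points P T)"
proof
  assume *: "sigma_porous P (nonporous_points P T)"
  have "porous P {x \<in> T. (x, T) \<in> P}"
    unfolding porous_def by (auto intro: P_antimono[of _ T])
  from sigma_porous_Un[OF * porous_imp_sigma_porous[OF this]]
  have "sigma_porous P T"
    by (rule sigma_porous_subset) (auto simp: nonporous_points_def)
  then show False using assms by blast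
qed

end

section \<open>Suslin sets\<close>

lemma closedin_imp_suslin_in:
  "closedin T C \<Longrightarrow> suslin_in T C"
  unfolding suslin_in_def by (intro exI[of _ "\<lambda>_. C"]) auto

lemma suslin_in_subset:
  assumes "suslin_in T S" shows "S \<subseteq> topspace T"
proof -
  obtain F :: "nat list \<Rightarrow> 'a set" where "\<And>s. closedin T (F s)"
    and "S = (\<Union>\<nu> :: nat \<Rightarrow> nat. \<Inter>n. F (map \<nu> [0..<n]))"
    using assms unfolding suslin_in_def by (elim exE conjE) (rule that, simp_all)
  then show ?thesis using closedin_subset[of T] by blast
qed

text \<open>
  For each point \<open>y\<close> of \<open>S\<close> the branch \<open>\<beta> y\<close> is one along which \<open>y\<close> lies in all sets of the
  Suslin scheme. The points whose branches agree with \<open>\<mu>\<close> below \<open>n\<close> lie in the closed set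
  attached to that initial segment of \<open>\<mu>\<close>, and a point of all these closed sets belongs to
  \<open>S\<close>.
\<close>

lemma suslin_in_branches:
  assumes "suslin_in T S"
  obtains \<beta> :: "'a \<Rightarrow> nat \<Rightarrow> nat"
  where "\<And>x \<mu>. (\<And>n. x \<in> T closure_of {y \<in> S. \<forall>i<n. \<beta> y i = \<mu> i}) \<Longrightarrow> x \<in> S"
proof -
  obtain F :: "nat list \<Rightarrow> 'a set" where F: "\<And>s. closedin T (F s)"
    and S: "S = (\<Union>\<nu> :: nat \<Rightarrow> nat. \<Inter>n. F (map \<nu> [0..<n]))"
    using assms unfolding suslin_in_def by (elim exE conjE) (rule that, simp_all)
  have "\<forall>y\<in>S. \<exists>\<nu>. \<forall>n. y \<in> F (map \<nu> [0..<n])" unfolding S by blast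
  then obtain \<beta> where \<beta>: "\<And>y n. y \<in> S \<Longrightarrow> y \<in> F (map (\<beta> y) [0..<n])" by metis
  show thesis
  proof (rule that)
    fix x \<mu> assume x: "\<And>n. x \<in> T closure_of {y \<in> S. \<forall>i<n. \<beta> y i = \<mu> i}"
    have "x \<in> F (map \<mu> [0..<n])" for n
    proof -
      have "y \<in> F (map \<mu> [0..<n])" if "y \<in> S" "\<forall>i<n. \<beta> y i = \<mu> i" for y
      proof -
        have "map (\<beta> y) [0..<n] = map \<mu> [0..<n]" using that by simp
        then show ?thesis using \<beta>[OF that(1), of n] by (simp only:)
      qed
      then have "T closure_of {y \<in> S. \<forall>i<n. \<beta> y i = \<mu> i} \<subseteq> F (map \<mu> [0..<n])"
        by (intro closure_of_minimal F) blast
      then show ?thesis using x by blast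
    qed
    then show "x \<in> S" unfolding S by blast
  qed
qed

section \<open>Foran systems\<close>

lemma small_powerset: "small {E. elts E \<subseteq> elts (a::'v::zfc)}"
proof -
  obtain b where "elts b = {E. elts E \<subseteq> elts a}" using powerset[of a] ..
  then show ?thesis unfolding small_def ..
qed

lemma small_pairs:
  assumes "small A" "small B"
  shows "small {vpair x y |x y. x \<in> A \<and> y \<in> B}"
proof -
  have "{vpair x y |x y. x \<in> A \<and> y \<in> B} = (\<Union>x\<in>A. vpair x ` B)" by auto
  then show ?thesis by (simp only: small_Union[OF assms(1) small_image[OF assms(2)]])
qed

text \<open>
  The reals inject into the subsets of a countable set by Dedekind cuts, and power sets are
  small.
\<close>

lemma small_range_real:
  fixes rc :: "real \<Rightarrow> 'v::zfc"
  assumes "inj rc"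
  shows "small (range rc)"
proof -
  define q where "q n = rc (of_rat (nat_to_rat_surj n))" for n
  define cut where "cut r = vset (q ` {n. of_rat (nat_to_rat_surj n) < r})" for r :: real
  have sm: "small (q ` A)" for A by (rule small_countable) simp
  have "inj cut"
  proof (rule linorder_injI)
    fix r s :: real assume "r < s"
    then obtain t where t: "r < of_rat t" "of_rat t < s" using of_rat_dense by blast
    obtain n where n: "t = nat_to_rat_surj n" using surj_nat_to_rat_surj by (metis surjD)
    have "q n \<in> elts (cut s)" using n t sm by (auto simp: cut_def elts_vset)
    moreover have "q n \<notin> elts (cut r)"
      using n t sm assms by (auto simp: cut_def elts_vset q_def inj_eq)
    ultimately show "cut r \<noteq> cut s" by auto
  qed
  then have "rc = (\<lambda>v. rc (inv cut v)) \<circ> cut" by (simp add: fun_eq_iff)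
  then have "range rc = (\<lambda>v. rc (inv cut v)) ` range cut" by (metis image_comp)
  moreover have "small (range cut)"
  proof (rule small_subset[OF small_vset_Pow])
    show "small (range q)" by (rule sm)
    show "range cut \<subseteq> vset ` Pow (range q)" by (auto simp: cut_def)
  qed
  ultimately show ?thesis by (simp add: small_image)
qed

text \<open>
  Here \<open>D\<close> codes the graph of the metric and \<open>L\<close> the relation \<open>r < 1 / (n + 1)\<close> between reals
  and natural numbers, so that this says \<open>d x y < 1 / (n + 1)\<close> in terms of membership only.
\<close>

definition near :: "'v::zfc \<Rightarrow> 'v \<Rightarrow> 'v \<Rightarrow> 'v \<Rightarrow> 'v \<Rightarrow> bool" where
  "near D L n x y \<longleftrightarrow> (\<exists>r. vpair (vpair x y) r \<in> elts D \<and> vpair r n \<in> elts L)"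

definition adherent :: "'v::zfc \<Rightarrow> 'v \<Rightarrow> 'v \<Rightarrow> 'v \<Rightarrow> 'v \<Rightarrow> bool" where
  "adherent D L \<omega> x E \<longleftrightarrow> (\<forall>n\<in>elts \<omega>. \<exists>y\<in>elts E. near D L n x y)"

text \<open>
  The elements of \<open>N\<close> are meant to be the non-sigma-porous subsets of a fixed set, those of
  \<open>S\<close> the Suslin sets, and \<open>p\<close> codes the porosity relation. The first part is the local
  largeness of a kernel; the second provides a node in a Suslin set all of whose points see
  \<open>T\<close> as nonporous.
\<close>

definition kernel :: "'v::zfc \<Rightarrow> 'v \<Rightarrow> 'v \<Rightarrow> 'v \<Rightarrow> 'v \<Rightarrow> 'v \<Rightarrow> 'v \<Rightarrow> bool" where
  "kernel D L \<omega> p N S T \<longleftrightarrow>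
     (\<forall>x\<in>elts T. \<forall>n\<in>elts \<omega>. \<exists>E\<in>elts N. elts E \<subseteq> elts T \<and> (\<forall>y\<in>elts E. near D L n x y)) \<and>
     (\<exists>s\<in>elts S. (\<exists>E\<in>elts N. elts E \<subseteq> elts T \<and> elts E \<subseteq> elts s) \<and>
        (\<forall>x\<in>elts s. \<not> vpair x T \<in> elts p))"

text \<open>
  A triple \<open>(s, n, E)\<close> in \<open>\<Delta>\<close> means that the \<open>n\<close>-th coordinate of the branches of the Suslin
  set \<open>s\<close> is constant on \<open>E\<close>. The last clause expresses that a limit point of a chain of nodes
  that decide all coordinates for \<open>s\<close> belongs to \<open>s\<close>; speaking of chains as sets avoids coding
  sequences in the language of set theory.
\<close>

definition foran_system ::
    "'v::zfc \<Rightarrow> 'v \<Rightarrow> 'v \<Rightarrow> 'v \<Rightarrow> 'v \<Rightarrow> 'v \<Rightarrow> 'v \<Rightarrow> 'v \<Rightarrow> bool" where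
  "foran_system D L \<omega> p a N S \<Delta> \<longleftrightarrow>
     a \<in> elts N \<and> a \<in> elts S \<and>
     (\<forall>E\<in>elts N. \<exists>x. x \<in> elts E) \<and>
     (\<forall>E\<in>elts N. elts E \<subseteq> elts a) \<and>
     (\<forall>E\<in>elts N. \<exists>T\<in>elts N. elts T \<subseteq> elts E \<and> kernel D L \<omega> p N S T) \<and>
     (\<forall>s\<in>elts S. \<forall>n\<in>elts \<omega>. \<forall>E\<in>elts N. elts E \<subseteq> elts s \<longrightarrow>
        (\<exists>E'\<in>elts N. elts E' \<subseteq> elts E \<and> vpair s (vpair n E') \<in> elts \<Delta>)) \<and>
     (\<forall>s\<in>elts S. \<forall>Z.
        elts Z \<subseteq> elts N \<and>
        (\<forall>E\<in>elts Z. \<forall>E'\<in>elts Z. elts E \<subseteq> elts E' \<or> elts E' \<subseteq> elts E) \<and>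
        (\<forall>n\<in>elts \<omega>. \<exists>E\<in>elts Z. vpair s (vpair n E) \<in> elts \<Delta>) \<longrightarrow>
        (\<forall>x. (\<forall>E\<in>elts Z. adherent D L \<omega> x E) \<longrightarrow> x \<in> elts s))"

lemma definable_near: "definable (\<lambda>e. near (e i) (e j) (e k) (e l) (e m))"
  unfolding near_def by (intro definable_intros)

lemma definable_adherent: "definable (\<lambda>e. adherent (e i) (e j) (e k) (e l) (e m))"
  unfolding adherent_def by (intro definable_intros definable_near)

lemma definable_kernel: "definable (\<lambda>e. kernel (e i) (e j) (e k) (e l) (e m) (e n) (e q))"
  unfolding kernel_def by (intro definable_intros definable_near)

lemma definable_foran_system:
  "definable (\<lambda>e. foran_system (e i) (e j) (e k) (e l) (e m) (e n) (e q) (e r))"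
  unfolding foran_system_def by (intro definable_intros definable_adherent definable_kernel)

text \<open>
  A metric space with a porosity-like relation, together with objects of the universe that
  represent its metric, its relation and the natural numbers. Any injective naming of the
  natural numbers serves the purpose.
\<close>

locale coded_porosity_space = porosity_space X d P
  for X :: "'v::zfc set" and d P +
  fixes D L \<omega> p :: 'v and num :: "nat \<Rightarrow> 'v"
  assumes small_carrier: "small X"
    and elts_\<omega>: "elts \<omega> = range num"
    and inj_num: "inj num"
    and near_iff: "near D L (num n) x y \<longleftrightarrow> x \<in> X \<and> y \<in> X \<and> d x y < 1 / Suc n"
    and mem_p_iff: "elts E \<subseteq> X \<Longrightarrow> vpair x E \<in> elts p \<longleftrightarrow> (x, elts E) \<in> P"
begin

lemma subset_code:
  assumes "B \<subseteq> X" obtains E where "elts E = B"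
  using small_subset[OF small_carrier assms] unfolding small_def by blast

lemma adherent_iff:
  assumes "elts E \<subseteq> X"
  shows "adherent D L \<omega> x E \<longleftrightarrow> x \<in> mtopology closure_of (elts E)"
  unfolding in_closure_of_iff[OF assms] adherent_def elts_\<omega> ball_simps(9) ball_UNIV near_iff
  using assms by (meson subsetD)

text \<open>
  Non-sigma-porous sets are the nodes. The Suslin set belonging to a kernel \<open>T\<close> consists of
  the points of the closure of \<open>T\<close> at which this closure is not porous. Passing to the closure
  matters: a kernel need not be Suslin, but closed sets are, so the hypothesis on nonporous
  points applies.
\<close>

lemma ex_foran_system:
  assumes suslin_nonporous:
    "\<And>S. suslin_in mtopology S \<Longrightarrow> suslin_in mtopology (nonporous_points P S)"
    and A: "suslin_in mtopology (elts a)" "\<not> sigma_porous P (elts a)"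
  shows "\<exists>N S \<Delta>. foran_system D L \<omega> p a N S \<Delta>"
proof -
  have aX: "elts a \<subseteq> X" using suslin_in_subset[OF A(1)] by simp
  obtain c where c: "elts c = X" using subset_code by blast
  define \<N> where "\<N> = {E. elts E \<subseteq> elts a \<and> \<not> sigma_porous P (elts E)}"
  define \<S> where "\<S> = {s. elts s \<subseteq> X \<and> suslin_in mtopology (elts s)}"
  have "\<forall>s. \<exists>\<beta>::'v \<Rightarrow> nat \<Rightarrow> nat. s \<in> \<S> \<longrightarrow>
      (\<forall>x \<mu>. (\<forall>n. x \<in> mtopology closure_of {y \<in> elts s. \<forall>i<n. \<beta> y i = \<mu> i}) \<longrightarrow> x \<in> elts s)"
  proof
    fix s
    show "\<exists>\<beta>::'v \<Rightarrow> nat \<Rightarrow> nat. s \<in> \<S> \<longrightarrow>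
      (\<forall>x \<mu>. (\<forall>n. x \<in> mtopology closure_of {y \<in> elts s. \<forall>i<n. \<beta> y i = \<mu> i}) \<longrightarrow> x \<in> elts s)"
    proof (cases "s \<in> \<S>")
      case True
      then have "suslin_in mtopology (elts s)" by (simp add: \<S>_def)
      then obtain \<beta> :: "'v \<Rightarrow> nat \<Rightarrow> nat" where
        "\<And>x \<mu>. (\<And>n. x \<in> mtopology closure_of {y \<in> elts s. \<forall>i<n. \<beta> y i = \<mu> i}) \<Longrightarrow> x \<in> elts s"
        by (rule suslin_in_branches) blast
      then show ?thesis by (intro exI[of _ \<beta>]) blast
    qed simp
  qed
  then obtain \<beta> :: "'v \<Rightarrow> 'v \<Rightarrow> nat \<Rightarrow> nat" where
    \<beta>: "\<And>s x \<mu>. s \<in> \<S> \<Longrightarrow>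
      (\<And>n. x \<in> mtopology closure_of {y \<in> elts s. \<forall>i<n. \<beta> s y i = \<mu> i}) \<Longrightarrow> x \<in> elts s"
    unfolding choice_iff by blast
  define \<D> where "\<D> = {vpair s (vpair (num n) E) |s n E.
      s \<in> \<S> \<and> E \<in> \<N> \<and> elts E \<subseteq> elts s \<and> (\<exists>l. \<forall>y\<in>elts E. \<beta> s y n = l)}"
  have "small \<N>"
    by (rule small_subset[OF small_powerset[of a]]) (auto simp: \<N>_def)
  moreover have "small \<S>"
    by (rule small_subset[OF small_powerset[of c]]) (auto simp: \<S>_def c)
  moreover have "small (range num)" by (rule small_countable) simp
  ultimately have "small {vpair s q |s q. s \<in> \<S> \<and> q \<in> {vpair m E |m E. m \<in> range num \<and> E \<in> \<N>}}"
    by (intro small_pairs)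
  then have "small \<D>"
    by (rule small_subset) (unfold \<D>_def, blast)
  obtain N S \<Delta> where N: "elts N = \<N>" and S: "elts S = \<S>" and \<Delta>: "elts \<Delta> = \<D>"
    using \<open>small \<N>\<close> \<open>small \<S>\<close> \<open>small \<D>\<close> unfolding small_def by blast
  have \<D>_iff: "vpair s (vpair (num n) E) \<in> \<D> \<longleftrightarrow>
      s \<in> \<S> \<and> E \<in> \<N> \<and> elts E \<subseteq> elts s \<and> (\<exists>l. \<forall>y\<in>elts E. \<beta> s y n = l)" for s n E
    unfolding \<D>_def using inj_num by (auto simp: vpair_eq_iff inj_eq)
  have code: "\<exists>E\<in>\<N>. elts E = B" if "B \<subseteq> elts a" "\<not> sigma_porous P B" for B
  proof -
    have "B \<subseteq> X" using that(1) aX by blast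
    then obtain E where "elts E = B" by (rule subset_code)
    then show ?thesis using that by (auto simp: \<N>_def)
  qed
  have carrier: "elts E \<subseteq> X" if "E \<in> \<N>" for E
    using that aX by (auto simp: \<N>_def)
  have kernel: "kernel D L \<omega> p N S T"
    if T: "T \<in> \<N>" "\<And>x r. x \<in> elts T \<Longrightarrow> 0 < r \<Longrightarrow> \<not> sigma_porous P (elts T \<inter> mball x r)" for T
    unfolding kernel_def N S elts_\<omega>
  proof (intro conjI ballI)
    fix x m assume x: "x \<in> elts T" and "m \<in> range num"
    then obtain n where n: "m = num n" by blast
    have "\<not> sigma_porous P (elts T \<inter> mball x (1 / Suc n))" by (rule T(2)[OF x]) simp
    then obtain E where "E \<in> \<N>" "elts E = elts T \<inter> mball x (1 / Suc n)"
      using code[of "elts T \<inter> mball x (1 / Suc n)"] T(1) by (auto simp: \<N>_def)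
    then show "\<exists>E\<in>\<N>. elts E \<subseteq> elts T \<and> (\<forall>y\<in>elts E. near D L m x y)"
      by (intro bexI[of _ E]) (auto simp: near_iff n)
  next
    have TX: "elts T \<subseteq> X" using carrier T(1) .
    let ?C = "mtopology closure_of (elts T)"
    have "suslin_in mtopology (nonporous_points P ?C)"
      by (intro suslin_nonporous closedin_imp_suslin_in) simp
    moreover from suslin_in_subset[OF this] have "nonporous_points P ?C \<subseteq> X" by simp
    then obtain s where s: "elts s = nonporous_points P ?C" by (rule subset_code)
    ultimately have "s \<in> \<S>"
      using suslin_in_subset[of mtopology "elts s"] by (simp add: \<S>_def)
    have CX: "?C \<subseteq> X" using closure_of_subset_topspace[of mtopology] by simp
    have iff: "(x, ?C) \<in> P \<longleftrightarrow> (x, elts T) \<in> P" if "x \<in> X" for x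
      by (rule P_closure[OF that TX])
    have "nonporous_points P (elts T) \<subseteq> elts T" by (auto simp: nonporous_points_def)
    moreover have "nonporous_points P (elts T) \<subseteq> elts s"
      using TX iff closure_of_subset[of "elts T" mtopology] by (auto simp: s nonporous_points_def)
    moreover have "\<not> sigma_porous P (nonporous_points P (elts T))"
      by (rule not_sigma_porous_nonporous_points) (use T(1) in \<open>simp add: \<N>_def\<close>)
    moreover have "elts T \<subseteq> elts a" using T(1) by (simp add: \<N>_def)
    ultimately have "\<exists>E\<in>\<N>. elts E \<subseteq> elts T \<and> elts E \<subseteq> elts s"
      using code[of "nonporous_points P (elts T)"] by (metis subset_trans)
    moreover have "\<forall>x\<in>elts s. vpair x T \<notin> elts p"
      using TX CX iff by (auto simp: mem_p_iff s nonporous_points_def)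
    ultimately show "\<exists>s\<in>\<S>. (\<exists>E\<in>\<N>. elts E \<subseteq> elts T \<and> elts E \<subseteq> elts s) \<and>
        (\<forall>x\<in>elts s. \<not> vpair x T \<in> elts p)"
      using \<open>s \<in> \<S>\<close> by blast
  qed
  have "foran_system D L \<omega> p a N S \<Delta>"
    unfolding foran_system_def N S \<Delta>
  proof (intro conjI ballI allI impI)
    show "a \<in> \<N>" "a \<in> \<S>" using A aX by (auto simp: \<N>_def \<S>_def)
  next
    fix E assume "E \<in> \<N>"
    then have "elts E \<noteq> {}"
      using porous_imp_sigma_porous[OF porous_empty, of P] by (auto simp: \<N>_def)
    then show "\<exists>x. x \<in> elts E" by blast
  next
    fix E assume "E \<in> \<N>"
    then show "elts E \<subseteq> elts a" by (simp add: \<N>_def)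
  next
    fix E assume E: "E \<in> \<N>"
    then have "\<not> sigma_porous P (elts E)" by (simp add: \<N>_def)
    then obtain B where B: "B \<subseteq> elts E" "\<not> sigma_porous P B"
      "\<And>x r. x \<in> B \<Longrightarrow> 0 < r \<Longrightarrow> \<not> sigma_porous P (B \<inter> mball x r)"
      using nonporous_kernel[OF carrier[OF E]] by metis
    moreover have "B \<subseteq> elts a" using B(1) E by (auto simp: \<N>_def)
    ultimately obtain T where "T \<in> \<N>" "elts T = B" using code by blast
    then show "\<exists>T\<in>\<N>. elts T \<subseteq> elts E \<and> kernel D L \<omega> p N S T"
      using B kernel by blast
  next
    fix s m E assume s: "s \<in> \<S>" "m \<in> elts \<omega>" and E: "E \<in> \<N>" "elts E \<subseteq> elts s"
    obtain n where n: "m = num n" using s(2) elts_\<omega> by blast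
    have "\<exists>l. \<not> sigma_porous P {y \<in> elts E. \<beta> s y n = l}"
    proof (rule ccontr)
      assume "\<not> ?thesis"
      then have "sigma_porous P (\<Union>l. {y \<in> elts E. \<beta> s y n = l})"
        by (intro sigma_porous_UN) simp
      moreover have "(\<Union>l. {y \<in> elts E. \<beta> s y n = l}) = elts E" by auto
      ultimately show False using E by (simp add: \<N>_def)
    qed
    then obtain l where l: "\<not> sigma_porous P {y \<in> elts E. \<beta> s y n = l}" ..
    moreover have "{y \<in> elts E. \<beta> s y n = l} \<subseteq> elts a" using E(1) by (auto simp: \<N>_def)
    ultimately obtain E' where E': "E' \<in> \<N>" "elts E' = {y \<in> elts E. \<beta> s y n = l}"
      using code by blast
    then have "elts E' \<subseteq> elts E" by auto
    moreover have "vpair s (vpair m E') \<in> \<D>" unfolding n \<D>_iff using s E E' by auto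
    ultimately show "\<exists>E'\<in>\<N>. elts E' \<subseteq> elts E \<and> vpair s (vpair m E') \<in> \<D>"
      using E'(1) by blast
  next
    fix s Z x
    assume s: "s \<in> \<S>"
      and Z: "elts Z \<subseteq> \<N> \<and>
        (\<forall>E\<in>elts Z. \<forall>E'\<in>elts Z. elts E \<subseteq> elts E' \<or> elts E' \<subseteq> elts E) \<and>
        (\<forall>n\<in>elts \<omega>. \<exists>E\<in>elts Z. vpair s (vpair n E) \<in> \<D>)"
      and x: "\<forall>E\<in>elts Z. adherent D L \<omega> x E"
    have "\<forall>n. \<exists>E\<in>elts Z. vpair s (vpair (num n) E) \<in> \<D>" using Z elts_\<omega> by auto
    then have "\<forall>n. \<exists>E l. E \<in> elts Z \<and> elts E \<subseteq> elts s \<and> (\<forall>y\<in>elts E. \<beta> s y n = l)"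
      unfolding \<D>_iff by meson
    then obtain E \<mu> where E: "\<And>n. E n \<in> elts Z" "\<And>n. elts (E n) \<subseteq> elts s"
      "\<And>n y. y \<in> elts (E n) \<Longrightarrow> \<beta> s y n = \<mu> n"
      by metis
    show "x \<in> elts s"
    proof (rule \<beta>[OF s])
      fix n
      \<comment> \<open>Finitely many members of a chain have a least one among them, so all coordinates up to \<open>n\<close>
            are constant on a single node.\<close>
      have "\<exists>F\<in>elts Z. \<forall>i\<le>n. elts F \<subseteq> elts (E i)"
      proof (induction n)
        case 0
        show ?case using E(1)[of 0] by auto
      next
        case (Suc n)
        then obtain F where F: "F \<in> elts Z" "\<forall>i\<le>n. elts F \<subseteq> elts (E i)" by blast
        then consider "elts F \<subseteq> elts (E (Suc n))" | "elts (E (Suc n)) \<subseteq> elts F"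
          using Z E(1) by blast
        then show ?case
        proof cases
          case 1
          then show ?thesis using F by (intro bexI[of _ F]) (auto simp: le_Suc_eq)
        next
          case 2
          then show ?thesis
            using F(2) E(1) by (intro bexI[of _ "E (Suc n)"]) (auto simp: le_Suc_eq)
        qed
      qed
      then obtain F where F: "F \<in> elts Z" "\<forall>i\<le>n. elts F \<subseteq> elts (E i)" by blast
      have "elts F \<subseteq> {y \<in> elts s. \<forall>i<n. \<beta> s y i = \<mu> i}"
        using F(2) E(2)[of 0] E(3) by (auto simp: subset_iff)
      then have "mtopology closure_of elts F \<subseteq> mtopology closure_of {y \<in> elts s. \<forall>i<n. \<beta> s y i = \<mu> i}"
        by (rule closure_of_mono)
      moreover have "x \<in> mtopology closure_of elts F"
      proof -
        have "F \<in> \<N>" using F(1) Z by (meson subsetD)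
        then show ?thesis using x F(1) adherent_iff[OF carrier[OF \<open>F \<in> \<N>\<close>]] by blast
      qed
      ultimately show "x \<in> mtopology closure_of {y \<in> elts s. \<forall>i<n. \<beta> s y i = \<mu> i}" by blast
    qed
  qed
  then show ?thesis by blast
qed

end

section \<open>Submodels closed under witnesses\<close>

text \<open>
  The object \<open>f\<close> is a partial function on the natural numbers whose values are porous sets
  with union \<open>a\<close>. Single-valuedness ensures that each value lies in a submodel that contains
  \<open>f\<close>.
\<close>

definition porous_cover :: "'v::zfc \<Rightarrow> 'v \<Rightarrow> 'v \<Rightarrow> 'v \<Rightarrow> bool" where
  "porous_cover \<omega> p a f \<longleftrightarrow>
     (\<forall>x\<in>elts a. \<exists>n\<in>elts \<omega>. \<exists>C. vpair n C \<in> elts f \<and> x \<in> elts C) \<and>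
     (\<forall>n C C'. vpair n C \<in> elts f \<and> vpair n C' \<in> elts f \<longrightarrow> C = C') \<and>
     (\<forall>n C. vpair n C \<in> elts f \<longrightarrow> elts C \<subseteq> elts a \<and> (\<forall>x\<in>elts C. vpair x C \<in> elts p))"

lemma definable_porous_cover: "definable (\<lambda>e. porous_cover (e i) (e j) (e k) (e l))"
  unfolding porous_cover_def by (intro definable_intros)

text \<open>
  The properties whose witnesses a submodel must contain. Variables 1 to 8 stand for \<open>D\<close>, \<open>L\<close>,
  \<open>\<omega>\<close>, \<open>p\<close>, the set \<open>a\<close> and the components \<open>N\<close>, \<open>S\<close>, \<open>\<Delta>\<close> of a Foran system; the variables from
  9 on are further parameters. In order, the predicates serve to find the metric in the code
  of the space, a nonporous point, a porous cover and its values, the three components of a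
  Foran system one after the other, a kernel, a node inside a ball, a Suslin set avoiding the
  points of porosity of a kernel, a node inside both the kernel and that set, a node on which
  a coordinate is decided, a point of a set, and a point of a set inside a ball.
\<close>

definition witness_predicates :: "((nat \<Rightarrow> 'v::zfc) \<Rightarrow> bool) list" where
  "witness_predicates =
    [\<lambda>e. \<exists>c. e 9 = vpair c (e 0),
     \<lambda>e. e 0 \<in> elts (e 5) \<and> \<not> vpair (e 0) (e 5) \<in> elts (e 4),
     \<lambda>e. porous_cover (e 3) (e 4) (e 5) (e 0),
     \<lambda>e. vpair (e 9) (e 0) \<in> elts (e 10),
     \<lambda>e. \<exists>S \<Delta>. foran_system (e 1) (e 2) (e 3) (e 4) (e 5) (e 0) S \<Delta>,
     \<lambda>e. \<exists>\<Delta>. foran_system (e 1) (e 2) (e 3) (e 4) (e 5) (e 6) (e 0) \<Delta>,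
     \<lambda>e. foran_system (e 1) (e 2) (e 3) (e 4) (e 5) (e 6) (e 7) (e 0),
     \<lambda>e. e 0 \<in> elts (e 6) \<and> elts (e 0) \<subseteq> elts (e 9) \<and>
       kernel (e 1) (e 2) (e 3) (e 4) (e 6) (e 7) (e 0),
     \<lambda>e. e 0 \<in> elts (e 6) \<and> elts (e 0) \<subseteq> elts (e 9) \<and>
       (\<forall>y\<in>elts (e 0). near (e 1) (e 2) (e 10) (e 11) y),
     \<lambda>e. e 0 \<in> elts (e 7) \<and>
       (\<exists>E\<in>elts (e 6). elts E \<subseteq> elts (e 9) \<and> elts E \<subseteq> elts (e 0)) \<and>
       (\<forall>x\<in>elts (e 0). \<not> vpair x (e 9) \<in> elts (e 4)),
     \<lambda>e. e 0 \<in> elts (e 6) \<and> elts (e 0) \<subseteq> elts (e 9) \<and> elts (e 0) \<subseteq> elts (e 10),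
     \<lambda>e. e 0 \<in> elts (e 6) \<and> elts (e 0) \<subseteq> elts (e 9) \<and>
       vpair (e 10) (vpair (e 11) (e 0)) \<in> elts (e 8),
     \<lambda>e. e 0 \<in> elts (e 9),
     \<lambda>e. e 0 \<in> elts (e 9) \<and> near (e 1) (e 2) (e 10) (e 11) (e 0)]"

lemma definable_witness_predicates: "Q \<in> set witness_predicates \<Longrightarrow> definable Q"
  unfolding witness_predicates_def list.set
  by (elim insertE emptyE; hypsubst;
      intro definable_intros definable_near definable_kernel definable_foran_system definable_porous_cover)

lemma second_component_in_M:
  assumes "\<And>Q. Q \<in> set witness_predicates \<Longrightarrow> skolem_closed M Q"
    and "vpair c D \<in> M"
  shows "D \<in> M"
proof -
  have "skolem_closed M (\<lambda>e. \<exists>c. e 9 = vpair c (e 0))"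
    by (rule assms(1)) (simp add: witness_predicates_def)
  then have "(\<exists>x c'. vpair c D = vpair c' x) \<longrightarrow> (\<exists>x\<in>M. \<exists>c'. vpair c D = vpair c' x)"
    using assms(2) unfolding skolem_closed_def by (elim allE[of _ "\<lambda>_. vpair c D"]) auto
  then show ?thesis by (auto simp: vpair_eq_iff)
qed

locale witness_closed =
  fixes D L \<omega> p :: "'v::zfc" and M :: "'v set"
  assumes witness_closed: "\<And>Q. Q \<in> set witness_predicates \<Longrightarrow> skolem_closed M Q"
    and parameters: "D \<in> M" "L \<in> M" "\<omega> \<in> M" "p \<in> M"
begin

text \<open>
  The default value \<open>w\<close> is the value of variable 11; the witness in variable 0 is put in
  later.
\<close>

definition env where
  "env a N S \<Delta> u v w =
    (\<lambda>_. w)(1 := D, 2 := L, 3 := \<omega>, 4 := p, 5 := a, 6 := N, 7 := S,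
      8 := \<Delta>, 9 := u, 10 := v)"

lemma witness:
  assumes "Q \<in> set witness_predicates"
    and "a \<in> M" "N \<in> M" "S \<in> M" "\<Delta> \<in> M" "u \<in> M" "v \<in> M" "w \<in> M"
    and "Q ((env a N S \<Delta> u v w)(0 := x))"
  shows "\<exists>x\<in>M. Q ((env a N S \<Delta> u v w)(0 := x))"
proof -
  have "range (env a N S \<Delta> u v w) \<subseteq> M"
    using assms(2-8) parameters by (auto simp: env_def)
  then show ?thesis using witness_closed[OF assms(1)] assms(9) unfolding skolem_closed_def by blast
qed

lemma witness_nonporous:
  assumes "a \<in> M"
    and "x \<in> elts a \<and> \<not> vpair x a \<in> elts p"
  shows "\<exists>x\<in>M. x \<in> elts a \<and> \<not> vpair x a \<in> elts p"
  using witness[of "\<lambda>e. e 0 \<in> elts (e 5) \<and>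
      \<not> vpair (e 0) (e 5) \<in> elts (e 4)"
      a \<omega> \<omega> \<omega> \<omega> \<omega> \<omega> x] assms parameters
  by (simp add: env_def witness_predicates_def)

lemma witness_cover:
  assumes "a \<in> M"
    and "porous_cover \<omega> p a x"
  shows "\<exists>x\<in>M. porous_cover \<omega> p a x"
  using witness[of "\<lambda>e. porous_cover (e 3) (e 4) (e 5) (e 0)"
      a \<omega> \<omega> \<omega> \<omega> \<omega> \<omega> x] assms parameters
  by (simp add: env_def witness_predicates_def)

lemma witness_value:
  assumes "u \<in> M" "v \<in> M"
    and "vpair u x \<in> elts v"
  shows "\<exists>x\<in>M. vpair u x \<in> elts v"
  using witness[of "\<lambda>e. vpair (e 9) (e 0) \<in> elts (e 10)"
      \<omega> \<omega> \<omega> \<omega> u v \<omega> x] assms parameters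
  by (simp add: env_def witness_predicates_def)

lemma witness_nodes:
  assumes "a \<in> M"
    and "\<exists>S \<Delta>. foran_system D L \<omega> p a x S \<Delta>"
  shows "\<exists>x\<in>M. \<exists>S \<Delta>. foran_system D L \<omega> p a x S \<Delta>"
  using witness[of "\<lambda>e. \<exists>S \<Delta>. foran_system (e 1) (e 2) (e 3) (e 4) (e 5) (e 0) S \<Delta>"
      a \<omega> \<omega> \<omega> \<omega> \<omega> \<omega> x] assms parameters
  by (simp add: env_def witness_predicates_def)

lemma witness_suslin_sets:
  assumes "a \<in> M" "N \<in> M"
    and "\<exists>\<Delta>. foran_system D L \<omega> p a N x \<Delta>"
  shows "\<exists>x\<in>M. \<exists>\<Delta>. foran_system D L \<omega> p a N x \<Delta>"
  using witness[of "\<lambda>e. \<exists>\<Delta>. foran_system (e 1) (e 2) (e 3) (e 4) (e 5) (e 6) (e 0) \<Delta>"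
      a N \<omega> \<omega> \<omega> \<omega> \<omega> x] assms parameters
  by (simp add: env_def witness_predicates_def)

lemma witness_decisions:
  assumes "a \<in> M" "N \<in> M" "S \<in> M"
    and "foran_system D L \<omega> p a N S x"
  shows "\<exists>x\<in>M. foran_system D L \<omega> p a N S x"
  using witness[of "\<lambda>e. foran_system (e 1) (e 2) (e 3) (e 4) (e 5) (e 6) (e 7) (e 0)"
      a N S \<omega> \<omega> \<omega> \<omega> x] assms parameters
  by (simp add: env_def witness_predicates_def)

lemma witness_kernel:
  assumes "N \<in> M" "S \<in> M" "u \<in> M"
    and "x \<in> elts N \<and>
      elts x \<subseteq> elts u \<and>
      kernel D L \<omega> p N S x"
  shows "\<exists>x\<in>M. x \<in> elts N \<and>
      elts x \<subseteq> elts u \<and>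
      kernel D L \<omega> p N S x"
  using witness[of "\<lambda>e. e 0 \<in> elts (e 6) \<and>
      elts (e 0) \<subseteq> elts (e 9) \<and>
      kernel (e 1) (e 2) (e 3) (e 4) (e 6) (e 7) (e 0)"
      \<omega> N S \<omega> u \<omega> \<omega> x] assms parameters
  by (simp add: env_def witness_predicates_def)

lemma witness_ball:
  assumes "N \<in> M" "u \<in> M" "v \<in> M" "w \<in> M"
    and "x \<in> elts N \<and>
      elts x \<subseteq> elts u \<and>
      (\<forall>y\<in>elts x. near D L v w y)"
  shows "\<exists>x\<in>M. x \<in> elts N \<and>
      elts x \<subseteq> elts u \<and>
      (\<forall>y\<in>elts x. near D L v w y)"
  using witness[of "\<lambda>e. e 0 \<in> elts (e 6) \<and>
      elts (e 0) \<subseteq> elts (e 9) \<and>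
      (\<forall>y\<in>elts (e 0). near (e 1) (e 2) (e 10) (e 11) y)"
      \<omega> N \<omega> \<omega> u v w x] assms parameters
  by (simp add: env_def witness_predicates_def)

lemma witness_suslin:
  assumes "N \<in> M" "S \<in> M" "u \<in> M"
    and "x \<in> elts S \<and>
      (\<exists>E\<in>elts N. elts E \<subseteq> elts u \<and> elts E \<subseteq> elts x) \<and>
      (\<forall>y\<in>elts x. \<not> vpair y u \<in> elts p)"
  shows "\<exists>x\<in>M. x \<in> elts S \<and>
      (\<exists>E\<in>elts N. elts E \<subseteq> elts u \<and> elts E \<subseteq> elts x) \<and>
      (\<forall>y\<in>elts x. \<not> vpair y u \<in> elts p)"
  using witness[of "\<lambda>e. e 0 \<in> elts (e 7) \<and>
      (\<exists>E\<in>elts (e 6). elts E \<subseteq> elts (e 9) \<and> elts E \<subseteq> elts (e 0)) \<and>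
      (\<forall>x\<in>elts (e 0). \<not> vpair x (e 9) \<in> elts (e 4))"
      \<omega> N S \<omega> u \<omega> \<omega> x] assms parameters
  by (simp add: env_def witness_predicates_def)

lemma witness_common_part:
  assumes "N \<in> M" "u \<in> M" "v \<in> M"
    and "x \<in> elts N \<and> elts x \<subseteq> elts u \<and> elts x \<subseteq> elts v"
  shows "\<exists>x\<in>M. x \<in> elts N \<and> elts x \<subseteq> elts u \<and> elts x \<subseteq> elts v"
  using witness[of "\<lambda>e. e 0 \<in> elts (e 6) \<and>
      elts (e 0) \<subseteq> elts (e 9) \<and>
      elts (e 0) \<subseteq> elts (e 10)"
      \<omega> N \<omega> \<omega> u v \<omega> x] assms parameters
  by (simp add: env_def witness_predicates_def)

lemma witness_decide:
  assumes "N \<in> M" "\<Delta> \<in> M" "u \<in> M" "v \<in> M" "w \<in> M"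
    and "x \<in> elts N \<and>
      elts x \<subseteq> elts u \<and>
      vpair v (vpair w x) \<in> elts \<Delta>"
  shows "\<exists>x\<in>M. x \<in> elts N \<and>
      elts x \<subseteq> elts u \<and>
      vpair v (vpair w x) \<in> elts \<Delta>"
  using witness[of "\<lambda>e. e 0 \<in> elts (e 6) \<and>
      elts (e 0) \<subseteq> elts (e 9) \<and>
      vpair (e 10) (vpair (e 11) (e 0)) \<in> elts (e 8)"
      \<omega> N \<omega> \<Delta> u v w x] assms parameters
  by (simp add: env_def witness_predicates_def)

lemma witness_point:
  assumes "u \<in> M"
    and "x \<in> elts u"
  shows "\<exists>x\<in>M. x \<in> elts u"
  using witness[of "\<lambda>e. e 0 \<in> elts (e 9)"
      \<omega> \<omega> \<omega> \<omega> u \<omega> \<omega> x] assms parameters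
  by (simp add: env_def witness_predicates_def)

lemma witness_near_point:
  assumes "u \<in> M" "v \<in> M" "w \<in> M"
    and "x \<in> elts u \<and> near D L v w x"
  shows "\<exists>x\<in>M. x \<in> elts u \<and> near D L v w x"
  using witness[of "\<lambda>e. e 0 \<in> elts (e 9) \<and> near (e 1) (e 2) (e 10) (e 11) (e 0)"
      \<omega> \<omega> \<omega> \<omega> u v w x] assms parameters
  by (simp add: env_def witness_predicates_def)

end

section \<open>Transfer of porosity to the closure of a submodel\<close>

text \<open>
  \<open>Y\<close> is the closure of the part of the space in \<open>M\<close>; the last assumption says that \<open>M\<close> is a
  pointwise model for \<open>P\<close> and \<open>P'\<close>.
\<close>

locale coded_submodel =
  coded_porosity_space X d P D L \<omega> p num + witness_closed D L \<omega> p M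
  for X :: "'v::zfc set" and d P D L \<omega> p num M +
  fixes Y :: "'v set" and P' :: "('v \<times> 'v set) set"
  assumes num_in_M: "num n \<in> M"
    and Y_def: "Y = mtopology closure_of (X \<inter> M)"
    and P'_porosity_like: "porosity_like Y d P'"
    and pointwise: "elts E \<subseteq> X \<Longrightarrow> E \<in> M \<Longrightarrow> x \<in> Y \<Longrightarrow>
      (x, elts E) \<in> P \<longleftrightarrow> (x, elts E \<inter> Y) \<in> P'"
begin

lemma Y_subset: "Y \<subseteq> X"
  using closure_of_subset_topspace[of mtopology "X \<inter> M"] by (simp add: Y_def)

lemma XM_subset_Y: "X \<inter> M \<subseteq> Y"
  unfolding Y_def by (rule closure_of_subset) simp

sublocale Y: porosity_space Y d P'
proof -
  interpret Submetric X d Y by unfold_locales (rule Y_subset)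
  show "porosity_space Y d P'" by unfold_locales (rule P'_porosity_like)
qed

lemma num_in_\<omega>: "num n \<in> elts \<omega>"
  by (simp add: elts_\<omega>)

lemma porous_iff:
  assumes "a \<in> M" "elts a \<subseteq> X"
  shows "porous P (elts a) \<longleftrightarrow> porous P' (elts a \<inter> Y)"
proof
  assume "porous P (elts a)"
  then show "porous P' (elts a \<inter> Y)"
    using pointwise[OF assms(2,1)] by (auto simp: porous_def)
next
  assume *: "porous P' (elts a \<inter> Y)"
  show "porous P (elts a)"
  proof (rule ccontr)
    assume "\<not> porous P (elts a)"
    then obtain x where "x \<in> elts a \<and> \<not> vpair x a \<in> elts p"
      using mem_p_iff[OF assms(2)] by (auto simp: porous_def)
    from witness_nonporous[OF assms(1) this]
    obtain y where y: "y \<in> M" "y \<in> elts a" "(y, elts a) \<notin> P"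
      using mem_p_iff[OF assms(2)] by auto
    then have "y \<in> Y" using XM_subset_Y assms(2) by auto
    then show False using pointwise[OF assms(2,1)] y * by (auto simp: porous_def)
  qed
qed

text \<open>
  A countable porous decomposition exists in the universe, hence one exists in \<open>M\<close>; its
  members are the values of a function in \<open>M\<close> at natural numbers, so they are in \<open>M\<close> and the
  pointwise model applies to them.
\<close>

lemma sigma_porous_imp_trace:
  assumes "a \<in> M" "elts a \<subseteq> X" "sigma_porous P (elts a)"
  shows "sigma_porous P' (elts a \<inter> Y)"
proof -
  obtain c :: "nat \<Rightarrow> 'v set" where c: "\<And>n. porous P (c n)" "elts a = (\<Union>n. c n)"
    using assms(3) unfolding sigma_porous_iff_sequence by blast
  \<comment> \<open>The decomposition is coded in the universe as a function on the natural numbers.\<close>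
  have "\<forall>n. \<exists>C. elts C = c n"
    using subset_code porous_carrier[OF c(1)] by metis
  then obtain C where C: "\<And>n. elts (C n) = c n" by metis
  have "small (range (\<lambda>n. vpair (num n) (C n)))" by (rule small_countable) simp
  then obtain f where f: "elts f = range (\<lambda>n. vpair (num n) (C n))" unfolding small_def by blast
  have f_iff: "vpair m B \<in> elts f \<longleftrightarrow> (\<exists>n. m = num n \<and> B = C n)" for m B
    unfolding f by (auto simp: vpair_eq_iff)
  have "porous_cover \<omega> p a f"
    unfolding porous_cover_def f_iff
  proof (intro conjI ballI allI impI)
    fix x assume "x \<in> elts a"
    then obtain n where "x \<in> elts (C n)" using c(2) C by auto
    then show "\<exists>m\<in>elts \<omega>. \<exists>B. (\<exists>n. m = num n \<and> B = C n) \<and> x \<in> elts B"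
      using num_in_\<omega> by blast
  next
    fix m B B' assume "(\<exists>n. m = num n \<and> B = C n) \<and> (\<exists>n. m = num n \<and> B' = C n)"
    then show "B = B'" using inj_num by (auto simp: inj_eq)
  next
    fix m B assume "\<exists>n. m = num n \<and> B = C n"
    then show "elts B \<subseteq> elts a" using c(2) C by auto
  next
    fix m B x assume "\<exists>n. m = num n \<and> B = C n" and x: "x \<in> elts B"
    then obtain n where n: "B = C n" by blast
    then have "elts B \<subseteq> X" using porous_carrier[OF c(1)] C by simp
    then show "vpair x B \<in> elts p"
      using c(1)[of n] x n C mem_p_iff by (auto simp: porous_def)
  qed
  from witness_cover[OF assms(1) this] obtain g where "g \<in> M" and g: "porous_cover \<omega> p a g" by blast
  define \<C> where "\<C> = {elts B \<inter> Y |m B. m \<in> elts \<omega> \<and> vpair m B \<in> elts g}"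
  show ?thesis
    unfolding sigma_porous_def
  proof (intro exI[of _ \<C>] conjI ballI)
    have "\<C> \<subseteq> (\<lambda>n. elts (THE B. vpair (num n) B \<in> elts g) \<inter> Y) ` UNIV"
    proof
      fix Q assume "Q \<in> \<C>"
      then obtain n B where B: "Q = elts B \<inter> Y" "vpair (num n) B \<in> elts g"
        unfolding \<C>_def elts_\<omega> by blast
      then have "(THE B. vpair (num n) B \<in> elts g) = B"
        using g unfolding porous_cover_def by (intro the_equality) blast+
      then show "Q \<in> (\<lambda>n. elts (THE B. vpair (num n) B \<in> elts g) \<inter> Y) ` UNIV"
        using B(1) by blast
    qed
    then show "countable \<C>" by (rule countable_subset) simp
  next
    fix Q assume "Q \<in> \<C>"
    then obtain m B where B: "Q = elts B \<inter> Y" "m \<in> elts \<omega>" "vpair m B \<in> elts g"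
      unfolding \<C>_def by blast
    have "m \<in> M" using B(2) num_in_M elts_\<omega> by auto
    from witness_value[OF this \<open>g \<in> M\<close> B(3)] obtain B' where "B' \<in> M" "vpair m B' \<in> elts g" by blast
    then have "B \<in> M" using g B(3) unfolding porous_cover_def by blast
    moreover have BX: "elts B \<subseteq> X" using g B(3) assms(2) unfolding porous_cover_def by (meson subset_trans)
    moreover have "(x, elts B) \<in> P" if "x \<in> elts B" for x
      using g B(3) that mem_p_iff[OF BX] unfolding porous_cover_def by blast
    ultimately show "porous P' Q" using pointwise[of B] unfolding porous_def B(1) by blast
  next
    show "elts a \<inter> Y = \<Union>\<C>"
    proof (intro equalityI subsetI)
      fix x assume x: "x \<in> elts a \<inter> Y"
      then obtain m B where "m \<in> elts \<omega>" "vpair m B \<in> elts g" "x \<in> elts B"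
        using g unfolding porous_cover_def by (elim conjE) (meson IntD1)
      then have "elts B \<inter> Y \<in> \<C>" "x \<in> elts B \<inter> Y" using x unfolding \<C>_def by blast+
      then show "x \<in> \<Union>\<C>" by (rule UnionI)
    next
      fix x assume "x \<in> \<Union>\<C>"
      then obtain m B where "vpair m B \<in> elts g" "x \<in> elts B \<inter> Y"
        unfolding \<C>_def by blast
      moreover have "elts B \<subseteq> elts a" if "vpair m B \<in> elts g" for m B
        using g that unfolding porous_cover_def by (elim conjE) (drule spec, drule spec, erule (1) impE, simp)
      ultimately show "x \<in> elts a \<inter> Y" by blast
    qed
  qed
qed

end

locale foran_submodel = coded_submodel X d P D L \<omega> p num M Y P'
  for X :: "'v::zfc set" and d P D L \<omega> p num M Y P' +
  fixes a N S \<Delta> :: 'v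
  assumes system: "foran_system D L \<omega> p a N S \<Delta>"
    and system_in_M: "a \<in> M" "N \<in> M" "S \<in> M" "\<Delta> \<in> M"
    and a_subset: "elts a \<subseteq> X"
begin

lemma N_subset: "E \<in> elts N \<Longrightarrow> elts E \<subseteq> elts a"
  and N_nonempty: "E \<in> elts N \<Longrightarrow> \<exists>x. x \<in> elts E"
  and a_in_N: "a \<in> elts N"
  and a_in_S: "a \<in> elts S"
  using system unfolding foran_system_def by simp_all

lemma kernel_in_M:
  assumes "E \<in> elts N \<inter> M"
  obtains T where "T \<in> elts N \<inter> M" "elts T \<subseteq> elts E" "kernel D L \<omega> p N S T"
proof -
  have "\<exists>T\<in>elts N. elts T \<subseteq> elts E \<and> kernel D L \<omega> p N S T"
    using system assms unfolding foran_system_def by simp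
  then obtain T where "T \<in> elts N \<and> elts T \<subseteq> elts E \<and> kernel D L \<omega> p N S T" by blast
  from witness_kernel[OF system_in_M(2,3) _ this] show thesis using that assms by blast
qed

lemma point_in_M:
  assumes "E \<in> elts N \<inter> M" obtains x where "x \<in> elts E" "x \<in> M" "x \<in> X"
proof -
  obtain x where "x \<in> elts E" using N_nonempty assms by blast
  from witness_point[OF _ this] show thesis using that assms N_subset a_subset by blast
qed

lemma kernel_ball_in_M:
  assumes "T \<in> elts N \<inter> M" "kernel D L \<omega> p N S T" "x \<in> elts T" "x \<in> M"
  obtains E where "E \<in> elts N \<inter> M" "elts E \<subseteq> elts T" "\<And>y. y \<in> elts E \<Longrightarrow> d x y < 1 / Suc n"
proof -
  obtain E where "E \<in> elts N \<and> elts E \<subseteq> elts T \<and> (\<forall>y\<in>elts E. near D L (num n) x y)"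
    using assms(2,3) num_in_\<omega>[of n] unfolding kernel_def by blast
  from witness_ball[OF system_in_M(2) _ num_in_M assms(4) this] obtain E' where
    "E' \<in> M" "E' \<in> elts N" "elts E' \<subseteq> elts T" "\<forall>y\<in>elts E'. near D L (num n) x y"
    using assms(1) by blast
  then show thesis using that by (simp add: near_iff)
qed

lemma shrink:
  assumes "E \<in> elts N \<inter> M"
  obtains E' x where "E' \<in> elts N \<inter> M" "elts E' \<subseteq> elts E" "x \<in> X"
    "\<And>y. y \<in> elts E' \<Longrightarrow> d x y < 1 / Suc n"
proof -
  obtain T where T: "T \<in> elts N \<inter> M" "elts T \<subseteq> elts E" "kernel D L \<omega> p N S T"
    using kernel_in_M[OF assms] .
  obtain x where x: "x \<in> elts T" "x \<in> M" "x \<in> X" using point_in_M[OF T(1)] .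
  obtain E' where "E' \<in> elts N \<inter> M" "elts E' \<subseteq> elts T" "\<And>y. y \<in> elts E' \<Longrightarrow> d x y < 1 / Suc n"
    using kernel_ball_in_M[OF T(1,3) x(1,2), of n] by blast
  then show thesis using that[of E' x] T(2) x(3) by blast
qed

lemma decide:
  assumes "E \<in> elts N \<inter> M" "s \<in> elts S \<inter> M" "elts E \<subseteq> elts s"
  obtains E' where "E' \<in> elts N \<inter> M" "elts E' \<subseteq> elts E" "vpair s (vpair (num n) E') \<in> elts \<Delta>"
proof -
  have "\<forall>s\<in>elts S. \<forall>n\<in>elts \<omega>. \<forall>E\<in>elts N. elts E \<subseteq> elts s \<longrightarrow>
        (\<exists>E'\<in>elts N. elts E' \<subseteq> elts E \<and> vpair s (vpair n E') \<in> elts \<Delta>)"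
    using system unfolding foran_system_def by blast
  then obtain E' where
    "E' \<in> elts N \<and> elts E' \<subseteq> elts E \<and> vpair s (vpair (num n) E') \<in> elts \<Delta>"
    using assms num_in_\<omega>[of n] by blast
  from witness_decide[OF system_in_M(2,4) _ _ num_in_M this] show thesis using assms that by blast
qed

text \<open>
  It suffices that \<open>C\<close> approximates the points of \<open>T \<inter> M\<close>, because \<open>T \<inter> M\<close> is dense in
  \<open>T \<inter> Y\<close>: a ball around a point of \<open>M\<close> that meets \<open>T\<close> meets it in a point of \<open>M\<close>.
\<close>

lemma dense_imp_adherent:
  assumes "T \<in> elts N \<inter> M"
    and dense: "\<And>y n. y \<in> elts T \<Longrightarrow> y \<in> M \<Longrightarrow> \<exists>c\<in>C. d y c < 1 / Suc n"
    and "C \<subseteq> Y"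
  shows "elts T \<inter> Y \<subseteq> Y.mtopology closure_of C"
proof
  fix z assume z: "z \<in> elts T \<inter> Y"
  then have zX: "z \<in> X" using Y_subset by blast
  have "\<exists>c\<in>C. d z c < r" if "r > 0" for r
  proof -
    obtain n where n: "1 / Suc n < r / 3"
      using reals_Archimedean[of "r / 3"] \<open>r > 0\<close> by (auto simp: inverse_eq_divide)
    obtain w where w: "w \<in> X" "w \<in> M" "d z w < 1 / Suc n"
      using z in_closure_of_iff[of "X \<inter> M" z] unfolding Y_def by blast
    have "near D L (num n) w z" using w zX by (simp add: near_iff commute)
    with z have "z \<in> elts T \<and> near D L (num n) w z" by blast
    from witness_near_point[OF _ num_in_M w(2) this] assms(1)
    obtain y where y: "y \<in> M" "y \<in> elts T" "d w y < 1 / Suc n" "y \<in> X"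
      by (auto simp: near_iff)
    obtain c where c: "c \<in> C" "d y c < 1 / Suc n" using dense[OF y(2,1)] by blast
    then have "c \<in> X" using assms(3) Y_subset by blast
    have "d z c \<le> d z w + (d w y + d y c)"
      using triangle[OF zX w(1) \<open>c \<in> X\<close>] triangle[OF w(1) y(4) \<open>c \<in> X\<close>] by linarith
    then show ?thesis using w(3) y(3) c n by (intro bexI[of _ c]) auto
  qed
  then show "z \<in> Y.mtopology closure_of C"
    using z Y.in_closure_of_iff_real[OF assms(3)] by blast
qed

text \<open>
  The dichotomy at the heart of the proof. If a ball around some point of \<open>T \<inter> M\<close> misses \<open>C\<close>,
  a smaller concentric ball keeps the limit away from \<open>C\<close>, and \<open>s\<close> can be \<open>a\<close> itself.
  Otherwise \<open>T \<inter> Y\<close> lies in the closure of \<open>C\<close>; then at a point of \<open>C\<close> porosity of \<open>C\<close> passes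
  to its closure, to \<open>T \<inter> Y\<close>, and, by the pointwise model, to \<open>T\<close>, whereas \<open>T\<close> is porous at no
  point of the Suslin set \<open>s\<close> provided by the kernel.
\<close>

lemma avoid:
  assumes E: "E \<in> elts N \<inter> M" and C: "porous P' C"
  obtains s E' where "s \<in> elts S \<inter> M" "E' \<in> elts N \<inter> M" "elts E' \<subseteq> elts E" "elts E' \<subseteq> elts s"
    "\<And>z. z \<in> elts s \<Longrightarrow> z \<in> mtopology closure_of elts E' \<Longrightarrow> z \<notin> C"
proof -
  obtain T where T: "T \<in> elts N \<inter> M" "elts T \<subseteq> elts E" "kernel D L \<omega> p N S T"
    using kernel_in_M[OF E] .
  have CY: "C \<subseteq> Y" using Y.porous_carrier[OF C] .
  have TX: "elts T \<subseteq> X" using T(1) N_subset a_subset by blast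
  show thesis
  proof (cases "\<exists>y n. y \<in> elts T \<and> y \<in> M \<and> (\<forall>c\<in>C. \<not> d y c < 1 / Suc n)")
    case True
    then obtain y n where y: "y \<in> elts T" "y \<in> M" and far: "\<And>c. c \<in> C \<Longrightarrow> \<not> d y c < 1 / Suc n"
      by blast
    obtain E' where E': "E' \<in> elts N \<inter> M" "elts E' \<subseteq> elts T"
      "\<And>x. x \<in> elts E' \<Longrightarrow> d y x < 1 / Suc (Suc n)"
      using kernel_ball_in_M[OF T(1,3) y] by metis
    have "z \<notin> C" if z: "z \<in> mtopology closure_of elts E'" for z
    proof
      assume "z \<in> C"
      \<comment> \<open>The node was taken in the ball of radius \<open>1 / (n + 2)\<close>, and \<open>?r\<close> is the remaining gap.\<close>
      let ?r = "1 / real (Suc n) - 1 / real (Suc (Suc n))"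
      have "1 / real (Suc (Suc n)) < 1 / real (Suc n)"
        by (intro divide_strict_left_mono) auto
      then have "?r > 0" by simp
      moreover have E'X: "elts E' \<subseteq> X" using E'(2) TX by blast
      ultimately obtain x where x: "x \<in> elts E'" "d z x < ?r"
        using z in_closure_of_iff_real[of "elts E'" z] by blast
      have "d y z \<le> d y x + d z x"
        using triangle[of y x z] y x CY Y_subset TX E'X \<open>z \<in> C\<close> commute[of x z] by auto
      then have "d y z < 1 / Suc n" using E'(3)[OF x(1)] x(2) by linarith
      then show False using far[OF \<open>z \<in> C\<close>] by blast
    qed
    moreover have "elts E' \<subseteq> elts a" using N_subset E'(1) by blast
    ultimately show thesis
      using that[of a E'] a_in_S system_in_M(1) E' T(2) by blast
  next
    case False
    then have adherent: "elts T \<inter> Y \<subseteq> Y.mtopology closure_of C"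
      using dense_imp_adherent[OF T(1) _ CY] by blast
    have *: "(z, elts T) \<in> P" if "z \<in> C" for z
    proof -
      have "z \<in> Y" using that CY by blast
      have "(z, C) \<in> P'" using C that by (simp add: porous_def)
      then have "(z, Y.mtopology closure_of C) \<in> P'" using Y.P_closure[OF \<open>z \<in> Y\<close> CY] by blast
      then have "(z, elts T \<inter> Y) \<in> P'" using adherent by (rule Y.P_antimono)
      then show ?thesis using pointwise[OF TX _ \<open>z \<in> Y\<close>] T(1) by blast
    qed
    obtain x where "x \<in> elts S \<and> (\<exists>E\<in>elts N. elts E \<subseteq> elts T \<and> elts E \<subseteq> elts x) \<and>
        (\<forall>y\<in>elts x. \<not> vpair y T \<in> elts p)"
      using T(3) unfolding kernel_def by blast
    from witness_suslin[OF system_in_M(2,3) _ this] T(1)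
    obtain s where s: "s \<in> M" "s \<in> elts S" "\<exists>E\<in>elts N. elts E \<subseteq> elts T \<and> elts E \<subseteq> elts s"
      "\<forall>y\<in>elts s. \<not> vpair y T \<in> elts p" by blast
    from s(3) obtain F where "F \<in> elts N \<and> elts F \<subseteq> elts T \<and> elts F \<subseteq> elts s" by blast
    from witness_common_part[OF system_in_M(2) _ s(1) this] T(1)
    obtain E' where "E' \<in> M" "E' \<in> elts N" "elts E' \<subseteq> elts T" "elts E' \<subseteq> elts s" by blast
    moreover have "z \<notin> C" if "z \<in> elts s" for z
      using s(4) that * mem_p_iff[OF TX] by blast
    ultimately show thesis using that[of s E'] s(1,2) T(2) by blast
  qed
qed

text \<open>
  The fusion argument. At step \<open>k\<close> the state consists of a node and of the Suslin sets
  \<open>h 0, \<dots>, h k\<close> containing it, of which \<open>h 0\<close> is \<open>a\<close>. The step avoids \<open>C k\<close>, which adds the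
  set \<open>h (k + 1)\<close>, shrinks the node to radius \<open>1 / (k + 1)\<close>, and decides coordinate \<open>i\<close> for
  the Suslin set \<open>h j\<close>, where \<open>(j, i)\<close> is the pair with number \<open>k\<close>. The \<open>j\<close> in the pair with
  number \<open>k\<close> is at most \<open>k\<close>, so \<open>h j\<close> is already present, and every pair is treated in the
  end.
\<close>

lemma ex_point_outside:
  fixes C :: "nat \<Rightarrow> 'v set"
  assumes complete: "mcomplete" and C: "\<And>k. porous P' (C k)"
  shows "\<exists>z \<in> elts a \<inter> Y. \<forall>k. z \<notin> C k"
proof -
  define Inv where "Inv k st \<longleftrightarrow> (case st of (E, h) \<Rightarrow> E \<in> elts N \<inter> M \<and> h 0 = a \<and>
      (\<forall>j\<le>k. h j \<in> elts S \<inter> M \<and> elts E \<subseteq> elts (h j)))" for k :: nat and st :: "'v \<times> (nat \<Rightarrow> 'v)"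
  define Step where "Step k st st' \<longleftrightarrow> (case st of (E, h) \<Rightarrow> case st' of (E', h') \<Rightarrow>
      elts E' \<subseteq> elts E \<and> (\<forall>j\<le>k. h' j = h j) \<and>
      (\<exists>x\<in>X. \<forall>y\<in>elts E'. d x y < 1 / Suc k) \<and>
      vpair (h (fst (prod_decode k))) (vpair (num (snd (prod_decode k))) E') \<in> elts \<Delta> \<and>
      (\<forall>z. z \<in> elts (h' (Suc k)) \<longrightarrow> z \<in> mtopology closure_of elts E' \<longrightarrow> z \<notin> C k))"
    for k :: nat and st st' :: "'v \<times> (nat \<Rightarrow> 'v)"
  have "\<exists>f. \<forall>k. Inv k (f k) \<and> Step k (f k) (f (Suc k))"
  proof (rule dependent_nat_choice)
    show "\<exists>st. Inv 0 st"
      by (rule exI[of _ "(a, \<lambda>_. a)"]) (simp add: Inv_def a_in_N a_in_S system_in_M)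
  next
    fix st k assume "Inv k st"
    then obtain E h where st: "st = (E, h)" and E: "E \<in> elts N \<inter> M" and h0: "h 0 = a"
      and h: "\<And>j. j \<le> k \<Longrightarrow> h j \<in> elts S \<inter> M \<and> elts E \<subseteq> elts (h j)"
      unfolding Inv_def by (cases st) auto
    obtain s E1 where s: "s \<in> elts S \<inter> M" and E1: "E1 \<in> elts N \<inter> M" "elts E1 \<subseteq> elts E"
      "elts E1 \<subseteq> elts s"
      and out: "\<And>z. z \<in> elts s \<Longrightarrow> z \<in> mtopology closure_of elts E1 \<Longrightarrow> z \<notin> C k"
      using avoid[OF E C] by metis
    obtain E2 x where E2: "E2 \<in> elts N \<inter> M" "elts E2 \<subseteq> elts E1" and x: "x \<in> X"
      "\<And>y. y \<in> elts E2 \<Longrightarrow> d x y < 1 / Suc k"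
      using shrink[OF E1(1)] by metis
    have "fst (prod_decode k) \<le> k"
      by (metis le_prod_encode_1 prod.collapse prod_decode_inverse)
    from h[OF this] have "h (fst (prod_decode k)) \<in> elts S \<inter> M" "elts E2 \<subseteq> elts (h (fst (prod_decode k)))"
      using E2(2) E1(2) by auto
    from decide[OF E2(1) this] obtain E' where E': "E' \<in> elts N \<inter> M" "elts E' \<subseteq> elts E2"
      "vpair (h (fst (prod_decode k))) (vpair (num (snd (prod_decode k))) E') \<in> elts \<Delta>" by metis
    have cl: "mtopology closure_of elts E' \<subseteq> mtopology closure_of elts E1"
      using E'(2) E2(2) by (intro closure_of_mono) blast
    have "Inv (Suc k) (E', h(Suc k := s))"
      unfolding Inv_def prod.case
    proof (intro conjI allI impI)
      show "E' \<in> elts N \<inter> M" by (rule E'(1))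
      show "(h(Suc k := s)) 0 = a" using h0 by simp
      fix j assume "j \<le> Suc k"
      then consider "j = Suc k" | "j \<le> k" by linarith
      then show "(h(Suc k := s)) j \<in> elts S \<inter> M" "elts E' \<subseteq> elts ((h(Suc k := s)) j)"
        using s h[of j] E'(2) E2(2) E1(2,3) by (cases; auto)+
    qed
    moreover have "Step k st (E', h(Suc k := s))"
      unfolding Step_def st prod.case
    proof (intro conjI allI impI)
      show "elts E' \<subseteq> elts E" using E'(2) E2(2) E1(2) by blast
      show "\<exists>x\<in>X. \<forall>y\<in>elts E'. d x y < 1 / real (Suc k)" using x E'(2) by blast
      show "vpair (h (fst (prod_decode k))) (vpair (num (snd (prod_decode k))) E') \<in> elts \<Delta>"
        by (rule E'(3))
      show "z \<notin> C k" if "z \<in> elts ((h(Suc k := s)) (Suc k))" "z \<in> mtopology closure_of elts E'" for z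
        using that out cl by auto
    qed simp
    ultimately show "\<exists>st'. Inv (Suc k) st' \<and> Step k st st'" by blast
  qed
  then obtain f where f: "\<And>k. Inv k (f k)" "\<And>k. Step k (f k) (f (Suc k))" by blast
  define E where "E k = fst (f k)" for k
  define H where "H k = snd (f k) k" for k
  have EN: "E k \<in> elts N \<inter> M" for k
    using f(1)[of k] by (auto simp: Inv_def E_def split: prod.splits)
  have H: "H k \<in> elts S \<inter> M" for k
    using f(1)[of k] by (auto simp: Inv_def H_def split: prod.splits)
  have H0: "H 0 = a"
    using f(1)[of 0] by (auto simp: Inv_def H_def split: prod.splits)
  have E_Suc: "elts (E (Suc k)) \<subseteq> elts (E k)"
    and h_Suc: "j \<le> k \<Longrightarrow> snd (f (Suc k)) j = snd (f k) j"
    and ball: "\<exists>x\<in>X. \<forall>y\<in>elts (E (Suc k)). d x y < 1 / Suc k"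
    and decided: "vpair (snd (f k) (fst (prod_decode k)))
        (vpair (num (snd (prod_decode k))) (E (Suc k))) \<in> elts \<Delta>"
    and out: "z \<in> elts (H (Suc k)) \<Longrightarrow> z \<in> mtopology closure_of elts (E (Suc k)) \<Longrightarrow> z \<notin> C k"
    for j k z
    using f(2)[of k] by (auto simp: Step_def E_def H_def split: prod.splits)
  have E_mono: "elts (E j) \<subseteq> elts (E k)" if "k \<le> j" for j k
    using that by (induction j rule: dec_induct) (use E_Suc in blast)+
  have h_eq: "snd (f k) j = H j" if "j \<le> k" for j k
    using that by (induction k rule: dec_induct) (simp_all add: H_def h_Suc)
  have decided': "vpair (H j) (vpair (num i) (E (Suc (prod_encode (j, i))))) \<in> elts \<Delta>" for i j
    using decided[of "prod_encode (j, i)"] h_eq[OF le_prod_encode_1] by simp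
  have EX: "elts (E k) \<subseteq> X" for k using EN[of k] N_subset a_subset by blast
  have "\<forall>k. \<exists>x. x \<in> elts (E k) \<and> x \<in> M" using point_in_M[OF EN] by metis
  then obtain \<sigma> where \<sigma>: "\<And>k. \<sigma> k \<in> elts (E k)" "\<And>k. \<sigma> k \<in> M" by metis
  have close: "d u v < 2 / Suc k" if "u \<in> elts (E (Suc k))" "v \<in> elts (E (Suc k))" for u v k
  proof -
    obtain x where x: "x \<in> X" "\<forall>y\<in>elts (E (Suc k)). d x y < 1 / Suc k" using ball by blast
    have "d u v \<le> d x u + d x v"
      using triangle[of u x v] that x(1) EX[of "Suc k"] commute[of u x] by auto
    also have "\<dots> < 1 / Suc k + 1 / Suc k" using x(2) that by (intro add_strict_mono) auto
    finally show ?thesis by simp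
  qed
  have "MCauchy \<sigma>"
    unfolding MCauchy_def
  proof (intro conjI allI impI)
    show "range \<sigma> \<subseteq> X" using \<sigma>(1) EX by blast
    fix \<epsilon> :: real assume "\<epsilon> > 0"
    then obtain k where k: "1 / real (Suc k) < \<epsilon> / 2"
      using reals_Archimedean[of "\<epsilon> / 2"] by (auto simp: inverse_eq_divide)
    show "\<exists>k. \<forall>n n'. k \<le> n \<longrightarrow> k \<le> n' \<longrightarrow> d (\<sigma> n) (\<sigma> n') < \<epsilon>"
    proof (intro exI[of _ "Suc k"] allI impI)
      fix n n' assume "Suc k \<le> n" "Suc k \<le> n'"
      then have "\<sigma> n \<in> elts (E (Suc k))" "\<sigma> n' \<in> elts (E (Suc k))"
        using \<sigma>(1) E_mono by blast+
      from close[OF this] show "d (\<sigma> n) (\<sigma> n') < \<epsilon>" using k by simp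
    qed
  qed
  then obtain z where z: "limitin mtopology \<sigma> z sequentially"
    using complete unfolding mcomplete_def by blast
  then have zX: "z \<in> X" and lim: "\<And>\<epsilon>. \<epsilon> > 0 \<Longrightarrow> \<exists>n. \<forall>k\<ge>n. d z (\<sigma> k) < \<epsilon>"
    unfolding limit_metric_sequentially using commute by metis+
  have "z \<in> mtopology closure_of (X \<inter> M)"
  proof -
    have "\<exists>y\<in>X \<inter> M. d z y < r" if "r > 0" for r
    proof -
      obtain n where "\<forall>k\<ge>n. d z (\<sigma> k) < r" using lim[OF \<open>r > 0\<close>] by blast
      then have "d z (\<sigma> n) < r" by blast
      moreover have "\<sigma> n \<in> X \<inter> M" using \<sigma> EX by blast
      ultimately show ?thesis by blast
    qed
    then show ?thesis using zX by (simp add: in_closure_of_iff_real)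
  qed
  then have zY: "z \<in> Y" by (simp add: Y_def)
  have zE: "z \<in> mtopology closure_of elts (E k)" for k
  proof -
    have "\<exists>y\<in>elts (E k). d z y < r" if "r > 0" for r
    proof -
      obtain n where "\<forall>k\<ge>n. d z (\<sigma> k) < r" using lim[OF \<open>r > 0\<close>] by blast
      then have "d z (\<sigma> (max n k)) < r" by simp
      moreover have "\<sigma> (max n k) \<in> elts (E k)" using \<sigma>(1) E_mono[of k "max n k"] by auto
      ultimately show ?thesis by blast
    qed
    then show ?thesis using zX in_closure_of_iff_real[OF EX] by blast
  qed
  have "small (range E)" by (rule small_countable) simp
  then obtain Z where Z: "elts Z = range E" unfolding small_def by blast
  have zH: "z \<in> elts (H j)" for j
  proof -
    have "elts Z \<subseteq> elts N \<and>
        (\<forall>E\<in>elts Z. \<forall>E'\<in>elts Z. elts E \<subseteq> elts E' \<or> elts E' \<subseteq> elts E) \<and>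
        (\<forall>n\<in>elts \<omega>. \<exists>E\<in>elts Z. vpair (H j) (vpair n E) \<in> elts \<Delta>)"
    proof (intro conjI ballI)
      show "elts Z \<subseteq> elts N" using EN Z by auto
      show "elts F \<subseteq> elts F' \<or> elts F' \<subseteq> elts F" if F: "F \<in> elts Z" "F' \<in> elts Z" for F F'
      proof -
        obtain k l where "F = E k" "F' = E l" using F Z by auto
        then show ?thesis using E_mono by (metis nat_le_linear)
      qed
      show "\<exists>E\<in>elts Z. vpair (H j) (vpair m E) \<in> elts \<Delta>" if "m \<in> elts \<omega>" for m
        using that decided' Z unfolding elts_\<omega> by blast
    qed
    moreover have "\<forall>E\<in>elts Z. adherent D L \<omega> z E"
      using zE adherent_iff[OF EX] Z by auto
    moreover have "\<forall>s\<in>elts S. \<forall>Z.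
        elts Z \<subseteq> elts N \<and>
        (\<forall>E\<in>elts Z. \<forall>E'\<in>elts Z. elts E \<subseteq> elts E' \<or> elts E' \<subseteq> elts E) \<and>
        (\<forall>n\<in>elts \<omega>. \<exists>E\<in>elts Z. vpair s (vpair n E) \<in> elts \<Delta>) \<longrightarrow>
        (\<forall>x. (\<forall>E\<in>elts Z. adherent D L \<omega> x E) \<longrightarrow> x \<in> elts s)"
      using system unfolding foran_system_def by (elim conjE)
    ultimately show ?thesis using H by blast
  qed
  have "z \<notin> C k" for k using out[OF zH zE] .
  moreover have "z \<in> elts a" using zH[of 0] H0 by simp
  ultimately show ?thesis using zY by blast
qed

end

section \<open>Coding of metric spaces and the transfer theorem\<close>

lemma near_code_iff:
  assumes "inj rc" and "small X"
  shows "near (vset ((\<lambda>(x, y). vpair (vpair x y) (rc (d x y))) ` (X \<times> X)))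
      (vset {vpair (rc r) (rc (real n)) |r n. r < 1 / Suc n}) (rc (real n)) x y \<longleftrightarrow>
    x \<in> X \<and> y \<in> X \<and> d x y < 1 / Suc n"
proof -
  have "small {vpair u v |u v. u \<in> range rc \<and> v \<in> range rc}"
    using small_range_real[OF assms(1)] by (intro small_pairs)
  then have "small {vpair (rc r) (rc (real n)) |r n. r < 1 / Suc n}"
    by (rule small_subset) blast
  then show ?thesis
    using assms(1) unfolding near_def
    by (auto simp: elts_vset small_metric_graph[OF assms(2)] vpair_eq_iff inj_eq)
qed

text \<open>
  The sets related by \<open>P\<close> are subsets of the small carrier, hence small and determined by
  their codes.
\<close>

lemma mem_vrelation_iff:
  assumes "small X" "P \<subseteq> X \<times> Pow X"
  shows "vpair x E \<in> elts (vrelation P) \<longleftrightarrow> (x, elts E) \<in> P"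
proof -
  have eq: "E = vset B \<longleftrightarrow> elts E = B" if "(x, B) \<in> P" for B
  proof (rule eq_vset_iff[OF small_subset[OF assms(1)]])
    show "B \<subseteq> X" using that assms(2) by auto
  qed
  have "vpair x E \<in> elts (vrelation P) \<longleftrightarrow> (\<exists>B. (x, B) \<in> P \<and> E = vset B)"
    unfolding vrelation_def elts_vset[OF small_relation[OF assms(1,2)]]
    by (force simp: vpair_eq_iff)
  also have "\<dots> \<longleftrightarrow> (\<exists>B. (x, B) \<in> P \<and> elts E = B)"
    using eq by (simp cong: conj_cong)
  finally show ?thesis by simp
qed

theorem proposition4p6:
  fixes rc :: "real \<Rightarrow> 'v::zfc"
  assumes "inj rc"
  shows "\<exists>(\<phi>s :: fm list) (Y :: 'v set). countable Y \<and>
    (\<forall>M. elem_submodel M \<phi>s Y \<longrightarrow>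
      (\<forall>X d P P' A.
        small X \<and> Metric_space X d \<and> Metric_space.mcomplete X d \<and>
        porosity_like X d P \<and>
        porosity_like (submodel_space X d M) d P' \<and>
        (\<forall>S. suslin_in (Metric_space.mtopology X d) S \<longrightarrow>
             suslin_in (Metric_space.mtopology X d) (nonporous_points P S)) \<and>
        vmetric_space rc X d \<in> M \<and> vrelation P \<in> M \<and>
        suslin_in (Metric_space.mtopology X d) A \<and> vset A \<in> M \<and>
        pointwise_model X d M P P' \<longrightarrow>
        (porous P A \<longleftrightarrow> porous P' (A \<inter> submodel_space X d M)) \<and>
        (sigma_porous P A \<longleftrightarrow> sigma_porous P' (A \<inter> submodel_space X d M))))"
proof -
  define num where "num n = rc (real n)" for n
  define \<omega> where "\<omega> = vset (range num)"
  define L where "L = vset {vpair (rc r) (num n) |r n. r < 1 / Suc n}"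
  obtain \<phi>s where \<phi>s: "\<And>M :: 'v set. (\<forall>\<phi>\<in>set \<phi>s. absolute_for M \<phi>) \<Longrightarrow>
      \<forall>Q\<in>set witness_predicates. skolem_closed M Q"
    using absolute_imp_skolem_closed_list[of witness_predicates] definable_witness_predicates by blast
  show ?thesis
  proof (intro exI[of _ \<phi>s] exI[of _ "insert \<omega> (insert L (range num))"] conjI allI impI)
    show "countable (insert \<omega> (insert L (range num)))" by simp
  next
    fix M :: "'v set" and X d P P' A
    assume "elem_submodel M \<phi>s (insert \<omega> (insert L (range num)))"
    then have closed: "\<And>Q. Q \<in> set witness_predicates \<Longrightarrow> skolem_closed M Q"
      and params: "\<omega> \<in> M" "L \<in> M" "\<And>n. num n \<in> M"
      using \<phi>s[of M] unfolding elem_submodel_def by auto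
    assume *: "small X \<and> Metric_space X d \<and> Metric_space.mcomplete X d \<and>
        porosity_like X d P \<and>
        porosity_like (submodel_space X d M) d P' \<and>
        (\<forall>S. suslin_in (Metric_space.mtopology X d) S \<longrightarrow>
             suslin_in (Metric_space.mtopology X d) (nonporous_points P S)) \<and>
        vmetric_space rc X d \<in> M \<and> vrelation P \<in> M \<and>
        suslin_in (Metric_space.mtopology X d) A \<and> vset A \<in> M \<and>
        pointwise_model X d M P P'"
    then have "small X" by blast
    define D where "D = vset ((\<lambda>(x, y). vpair (vpair x y) (rc (d x y))) ` (X \<times> X))"
    define Y where Y_eq: "Y = submodel_space X d M"
    interpret Metric_space X d using * by blast
    have PX: "P \<subseteq> X \<times> Pow X" using * unfolding porosity_like_def by (elim conjE)
    have AX: "A \<subseteq> X" using * suslin_in_subset[of mtopology A] by simp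
    define a where "a = vset A"
    have a: "elts a = A" unfolding a_def by (rule elts_vset[OF small_subset[OF \<open>small X\<close> AX]])
    have "vpair (vset X) D \<in> M" using * unfolding D_def vmetric_space_def by (elim conjE)
    with closed have "D \<in> M" by (rule second_component_in_M)
    interpret coded_submodel X d P D L \<omega> "vrelation P" num M Y P'
    proof unfold_locales
      show "elts \<omega> = range num"
        unfolding \<omega>_def by (rule elts_vset) (rule small_countable, simp)
      show "inj num" unfolding num_def inj_on_def using assms by (simp add: inj_eq)
      show "near D L (num n) x y \<longleftrightarrow> x \<in> X \<and> y \<in> X \<and> d x y < 1 / Suc n" for n x y
        unfolding D_def L_def num_def by (rule near_code_iff[OF assms \<open>small X\<close>])
      show "vpair x E \<in> elts (vrelation P) \<longleftrightarrow> (x, elts E) \<in> P" for x E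
        by (rule mem_vrelation_iff[OF \<open>small X\<close> PX])
      show "(x, elts E) \<in> P \<longleftrightarrow> (x, elts E \<inter> Y) \<in> P'" if "elts E \<subseteq> X" "E \<in> M" "x \<in> Y" for x E
      proof -
        have "vset (elts E) = E" by (rule extensionality) (simp add: elts_vset)
        moreover have "\<forall>A. A \<subseteq> X \<and> vset A \<in> M \<longrightarrow> (\<forall>x\<in>Y. (x, A) \<in> P \<longleftrightarrow> (x, A \<inter> Y) \<in> P')"
          using * unfolding pointwise_model_def Y_eq by (elim conjE)
        ultimately show ?thesis using that by simp
      qed
      show "Y = mtopology closure_of (X \<inter> M)" by (simp add: Y_eq submodel_space_def)
      show "porosity_like X d P" using * by (elim conjE)
      show "vrelation P \<in> M" using * by (elim conjE)
      show "porosity_like Y d P'" using * unfolding Y_eq by (elim conjE)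
    qed (fact closed params \<open>D \<in> M\<close> \<open>small X\<close>)+
    have aM: "a \<in> M" and aX: "elts a \<subseteq> X" using * AX a by (simp_all add: a_def)
    show "porous P A \<longleftrightarrow> porous P' (A \<inter> submodel_space X d M)"
      using porous_iff[OF aM aX] by (simp only: a Y_eq)
    show "sigma_porous P A \<longleftrightarrow> sigma_porous P' (A \<inter> submodel_space X d M)"
    proof
      assume "sigma_porous P A"
      then show "sigma_porous P' (A \<inter> submodel_space X d M)"
        using sigma_porous_imp_trace[OF aM aX] by (simp only: a Y_eq)
    next
      assume "sigma_porous P' (A \<inter> submodel_space X d M)"
      then obtain C :: "nat \<Rightarrow> 'v set" where C: "\<And>k. porous P' (C k)" "elts a \<inter> Y = (\<Union>k. C k)"
        unfolding sigma_porous_iff_sequence a Y_eq by blast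
      show "sigma_porous P A"
      proof (rule ccontr)
        assume "\<not> sigma_porous P A"
        then have "\<exists>N S \<Delta>. foran_system D L \<omega> (vrelation P) a N S \<Delta>"
          using * by (intro ex_foran_system) (auto simp: a)
        then obtain N where "\<exists>S \<Delta>. foran_system D L \<omega> (vrelation P) a N S \<Delta>" ..
        from witness_nodes[OF aM this] obtain N where "N \<in> M"
          and "\<exists>S \<Delta>. foran_system D L \<omega> (vrelation P) a N S \<Delta>" by blast
        then obtain S where "\<exists>\<Delta>. foran_system D L \<omega> (vrelation P) a N S \<Delta>" by blast
        from witness_suslin_sets[OF aM \<open>N \<in> M\<close> this] obtain S where "S \<in> M"
          and "\<exists>\<Delta>. foran_system D L \<omega> (vrelation P) a N S \<Delta>" by blast
        then obtain \<Delta> where "foran_system D L \<omega> (vrelation P) a N S \<Delta>" by blast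
        from witness_decisions[OF aM \<open>N \<in> M\<close> \<open>S \<in> M\<close> this] obtain \<Delta> where "\<Delta> \<in> M"
          and "foran_system D L \<omega> (vrelation P) a N S \<Delta>" by blast
        then interpret foran_submodel X d P D L \<omega> "vrelation P" num M Y P' a N S \<Delta>
          using aM \<open>N \<in> M\<close> \<open>S \<in> M\<close> aX by unfold_locales
        have "\<exists>z \<in> elts a \<inter> Y. \<forall>k. z \<notin> C k"
          using * C(1) by (intro ex_point_outside) auto
        then show False using C(2) by blast
      qed
    qed
  qed
qed

end
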